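(* Let $\mathbf X(t)=(X_1(t),\dots,X_d(t))$ be a $d$-dimensional inhomogeneous birth-death process as described in the context, and suppose that for some $j\in\{1,\dots,d\}$ the bounds $l_j\le \lambda_{j,\mathbf m}(t)\le L_j$ (all $\mathbf m$, $t\ge 0$) and $m_j^{*}\le \mu_{j,\mathbf m}(t)\le M_j$ (all $\mathbf m$ with $j$-th coordinate at least $1$, $t\ge0$) hold with nonnegative constants satisfying $$M_j<l_j .$$ Put $\sigma=\sqrt{M_j/l_j}<1$ and $\alpha^{*}=\left(\sqrt{l_j}-\sqrt{M_j}\right)^2$. For an initial distribution $\mathbf p(0)$ of $\mathbf X$, let $x_k(t)=\Pr(X_j(t)=k)$, $k=0,1,2,\dots$, and $\tilde{\mathbf x}(t)=(\tilde x_0(t),\tilde x_1(t),\dots)$ with $\tilde x_n(t)=\sigma^n x_n(t)$. Then: (i) $X_j(t)$ is null-ergodic, i.e. for every initial distribution $\mathbf p(0)$ of $\mathbf X$ and every $k\ge 0$, $x_k(t)\to 0$ as $t\to\infty$; (ii) for every initial distribution $\mathbf p(0)$ and all $t\ge 0$, $$\|\tilde{\mathbf x}(t)\|\le e^{-\alpha^{*}t}\,\|\tilde{\mathbf x}(0)\|;$$ (iii) for all integers $n,k\ge 0$, all $t\ge 0$, and every initial distribution with $\Pr(X_j(0)=k)>0$, $$\Pr\left(X_j(t)\le n\mid X_j(0)=k\right)\le \sigma^{k-n}\,e^{-\alpha^{*}t}.$$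
   Context: Setting. $\mathbf X(t)=(X_1(t),\dots,X_d(t))$, $t\ge 0$, is a continuous-time (time-inhomogeneous) Markov chain with state space $\mathbb Z_{\ge 0}^d$. Write states as $\mathbf m=(m_1,\dots,m_d)$, and let $\mathbf e_i$ be the $i$-th unit vector. The only transitions possible with order $h$ in $(t,t+h)$ are: $\mathbf m\to\mathbf m+\mathbf e_i$ (birth of a particle of type $i$), with intensity $\lambda_{i,\mathbf m}(t)$, and $\mathbf m\to\mathbf m-\mathbf e_i$ (death of a particle of type $i$, possible only if $m_i\ge1$; put $\mu_{i,\mathbf m}(t)=0$ if $m_i=0$), with intensity $\mu_{i,\mathbf m}(t)$. All intensities are nonnegative functions of $t$, locally integrable on $[0,\infty)$, and there are finite constants $L,M$ with $\lambda_{i,\mathbf m}(t)\le L$ and $\mu_{i,\mathbf m}(t)\le M$ for all $i$, all $\mathbf m$ and almost all $t\ge 0$. After enumerating the states by $0,1,2,\dots$ and writing $q_{ab}(t)$ for the resulting intensity of the transition from state $a$ to state $b$, the transition probabilities satisfy $\Pr(\mathbf X(t+h)=b\mid \mathbf X(t)=a)=q_{ab}(t)h+\alpha_{ab}(t,h)$ for $b\ne a$, and $=1-\sum_{c\neq a}q_{ac}(t)h+\alpha_a(t,h)$ for $b=a$, where all $\alpha_a(t,h)$ are $o(h)$ uniformly in $a$, i.e. $\sup_a|\alpha_a(t,h)|=o(h)$. Let $p_{\mathbf m}(t)=\Pr(\mathbf X(t)=\mathbf m)$, and let $\mathbf p(t)$ be the vector of these probabilities. It is the unique solution in $\ell_1$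 (for the given initial distribution $\mathbf p(0)$) of the forward Kolmogorov system $$\frac{dp_{\mathbf m}}{dt}=\sum_i\lambda_{i,\mathbf m-\mathbf e_i}(t)p_{\mathbf m-\mathbf e_i}+\sum_i\mu_{i,\mathbf m+\mathbf e_i}(t)p_{\mathbf m+\mathbf e_i}-\sum_i\left(\lambda_{i,\mathbf m}(t)+\mu_{i,\mathbf m}(t)\right)p_{\mathbf m}$$ (terms indexed by vectors outside $\mathbb Z_{\ge0}^d$ are zero; the equation is understood for almost all $t$). Thus $x_k(t)=\sum_{\mathbf m:\,m_j=k}p_{\mathbf m}(t)$. $\|\cdot\|$ denotes the $\ell_1$-norm, $\|\mathbf x\|=\sum_i|x_i|$. Conventions: $0^0=1$, and if $\sigma=0$ and $n>k$ then $\sigma^{k-n}$ is read as $+\infty$ (the bound in (iii) is then vacuous). *)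

theory Defs
  imports "HOL-Probability.Probability"
begin

(* A state is m :: nat^'d, with d = CARD('d); the i-th unit vector is axis i 1.
   Subtraction on nat^'d truncates, so every use of m - axis i 1 is guarded by m $ i > 0. *)

definition transition_intensity ::
  "('d::finite \<Rightarrow> nat^'d \<Rightarrow> real \<Rightarrow> real) \<Rightarrow> ('d \<Rightarrow> nat^'d \<Rightarrow> real \<Rightarrow> real) \<Rightarrow>
   real \<Rightarrow> nat^'d \<Rightarrow> nat^'d \<Rightarrow> real" where
  "transition_intensity lam mu t a b =
     (\<Sum>i\<in>UNIV. (if b = a + axis i 1 then lam i a t else 0)
            + (if a $ i > 0 \<and> b = a - axis i 1 then mu i a t else 0))"

definition forward_rhs ::
  "('d::finite \<Rightarrow> nat^'d \<Rightarrow> real \<Rightarrow> real) \<Rightarrow> ('d \<Rightarrow> nat^'d \<Rightarrow> real \<Rightarrow> real) \<Rightarrow>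
   real \<Rightarrow> (nat^'d \<Rightarrow> real) \<Rightarrow> nat^'d \<Rightarrow> real" where
  "forward_rhs lam mu t p m =
     (\<Sum>i\<in>UNIV. if m $ i > 0 then lam i (m - axis i 1) t * p (m - axis i 1) else 0)
   + (\<Sum>i\<in>UNIV. mu i (m + axis i 1) t * p (m + axis i 1))
   - (\<Sum>i\<in>UNIV. lam i m t + mu i m t) * p m"

(* The usual epsilon-delta notion for real functions; D ranges over the finite families of
   non-overlapping compact subintervals {Inf K..Sup K} of S. *)
definition abs_continuous_on :: "real set \<Rightarrow> (real \<Rightarrow> real) \<Rightarrow> bool" where
  "abs_continuous_on S f \<longleftrightarrow>
     (\<forall>e>0. \<exists>d>0. \<forall>D. D division_of \<Union>D \<and> \<Union>D \<subseteq> S \<and> (\<Sum>K\<in>D. Sup K - Inf K) < d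
        \<longrightarrow> (\<Sum>K\<in>D. \<bar>f (Sup K) - f (Inf K)\<bar>) < e)"

(* Caratheodory solutions: locally absolutely continuous components that satisfy the
   equations for almost all t. *)
definition forward_solution ::
  "('d::finite \<Rightarrow> nat^'d \<Rightarrow> real \<Rightarrow> real) \<Rightarrow> ('d \<Rightarrow> nat^'d \<Rightarrow> real \<Rightarrow> real) \<Rightarrow>
   (real \<Rightarrow> nat^'d \<Rightarrow> real) \<Rightarrow> bool" where
  "forward_solution lam mu p \<longleftrightarrow>
     (\<forall>m. (\<forall>T\<ge>0. abs_continuous_on {0..T} (\<lambda>t. p t m)) \<and>
          (AE t in lebesgue. 0 \<le> t \<longrightarrow>
             ((\<lambda>s. p s m) has_real_derivative forward_rhs lam mu t (p t) m) (at t)))"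

(* Pr p0 is the law of the process started from the initial distribution p0, and
   P s t a is the distribution of X t given X s = a; P does not depend on p0. *)
locale birth_death_process =
  fixes lam mu :: "'d::finite \<Rightarrow> nat^'d \<Rightarrow> real \<Rightarrow> real"
    and P :: "real \<Rightarrow> real \<Rightarrow> nat^'d \<Rightarrow> (nat^'d) pmf"
    and Pr :: "(nat^'d) pmf \<Rightarrow> 'w measure"
    and X :: "real \<Rightarrow> 'w \<Rightarrow> nat^'d"
  assumes intensity_nonneg:
      "\<And>i m t. 0 \<le> t \<Longrightarrow> 0 \<le> lam i m t" "\<And>i m t. 0 \<le> t \<Longrightarrow> 0 \<le> mu i m t"
    and no_death: "\<And>i m t. 0 \<le> t \<Longrightarrow> m $ i = 0 \<Longrightarrow> mu i m t = 0"
    and locally_integrable: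
      "\<And>i m T. 0 \<le> T \<Longrightarrow> lam i m absolutely_integrable_on {0..T}"
      "\<And>i m T. 0 \<le> T \<Longrightarrow> mu i m absolutely_integrable_on {0..T}"
    and intensity_bounded:
      "\<exists>L. \<forall>i m. AE t in lebesgue. 0 \<le> t \<longrightarrow> lam i m t \<le> L"
      "\<exists>M. \<forall>i m. AE t in lebesgue. 0 \<le> t \<longrightarrow> mu i m t \<le> M"
    and prob_space: "\<And>p0. prob_space (Pr p0)"
    and measurable: "\<And>p0 t. 0 \<le> t \<Longrightarrow> X t \<in> measurable (Pr p0) (count_space UNIV)"
    and initial: "\<And>p0 a. \<P>(w in Pr p0. X 0 w = a) = pmf p0 a"
    (* F is the finite set of earlier observation times, x the values observed there. *)
    and markov: "\<And>p0 s t F x a b. 0 \<le> s \<Longrightarrow> s \<le> t \<Longrightarrow> finite F \<Longrightarrow> F \<subseteq> {0..s} \<Longrightarrow>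
        \<P>(w in Pr p0. X s w = a \<and> (\<forall>r\<in>F. X r w = x r)) > 0 \<Longrightarrow>
        \<P>(w in Pr p0. X t w = b \<bar> X s w = a \<and> (\<forall>r\<in>F. X r w = x r)) = pmf (P s t a) b"
    and transition_off_diagonal: "AE t in lebesgue. 0 \<le> t \<longrightarrow> (\<forall>a b. b \<noteq> a \<longrightarrow>
        (\<lambda>h. pmf (P t (t + h) a) b - transition_intensity lam mu t a b * h)
          \<in> o[at_right 0](\<lambda>h. h))"
    and transition_diagonal: "AE t in lebesgue. 0 \<le> t \<longrightarrow>
        uniform_limit UNIV
          (\<lambda>h a. (pmf (P t (t + h) a) a
                    - (1 - (\<Sum>\<^sub>\<infinity>c\<in>-{a}. transition_intensity lam mu t a c) * h)) / h)
          (\<lambda>a. 0) (at_right 0)"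
    and forward_kolmogorov:
      "\<And>p0. forward_solution lam mu (\<lambda>t m. \<P>(w in Pr p0. X t w = m))"

definition null_ergodic :: "('i \<Rightarrow> 'w measure) \<Rightarrow> (real \<Rightarrow> 'w \<Rightarrow> nat) \<Rightarrow> bool" where
  "null_ergodic Pr Y \<longleftrightarrow> (\<forall>p0 k. ((\<lambda>t. \<P>(w in Pr p0. Y t w = k)) \<longlongrightarrow> 0) at_top)"

definition l1_norm :: "(nat \<Rightarrow> real) \<Rightarrow> real" where
  "l1_norm x = (\<Sum>\<^sub>\<infinity>n. \<bar>x n\<bar>)"

end

theory Submission
  imports Defs
begin

text \<open>
  Apply the forward equation to the weight $\sigma^{m_j}$. A birth of type $j$ multiplies it by
  $\sigma$, a death divides it by $\sigma$, and the choice $\sigma = \sqrt{M_j / l_j}$ makes the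
  net rate at most $-(l_j - l_j\sigma + M_j - M_j/\sigma) = -\alpha^*$ in every state, so that
  $E\,\sigma^{X_j(t)}$ decays like $e^{-\alpha^* t}$. To interchange derivative and sum, the weight is
  first multiplied by the cut-off $\max(0, 1 - |m|/R)$. Births only decrease the cut-off and deaths
  increase it by at most $1/R$, so the sums become finite at the price of an error $O(1/R)$, which
  Gronwall's inequality for absolutely continuous functions carries through to the limit
  $R \to \infty$. The conditional bound is Markov's inequality for the chain started at a point.
\<close>

section \<open>Absolutely continuous functions\<close>

text \<open>The base of the weight is the best possible one. With birth rate l and death rate u > 0,
  the weight \<sigma>^m decays at rate l (1 - \<sigma>) - u (1/\<sigma> - 1) in a state m > 0. This
  is concave in \<sigma> > 0 and is largest at sqrt(u/l), with value (sqrt l - sqrt u)^2. In a state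
  without particles of type j nothing dies, and births alone must supply the rate.

  Two obstacles shape the proof. The components of a forward solution are only absolutely continuous
  and satisfy their equations almost everywhere, so the passage from the sign of a derivative to
  monotonicity needs its own covering argument. And Mj = 0 is degenerate: then \<sigma> = 0 and the
  weight sees only the states with m_j = 0. Null-ergodicity and the conditional bound are therefore
  derived with a positive base, after the death bound has been replaced by a larger one; for the
  conditional bound that larger one is then sent back to 0.\<close>

lemma abs_continuous_onE:
  assumes "abs_continuous_on S f" "0 < e"
  obtains d where "0 < d"
    "\<forall>D. D division_of \<Union>D \<and> \<Union>D \<subseteq> S \<and> (\<Sum>K\<in>D. Sup K - Inf K) < d
        \<longrightarrow> (\<Sum>K\<in>D. \<bar>f (Sup K) - f (Inf K)\<bar>) < e"
  using assms unfolding abs_continuous_on_def by blast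

lemma abs_continuous_on_const: "abs_continuous_on S (\<lambda>t. c)"
  unfolding abs_continuous_on_def by (auto intro!: exI[of _ 1])

text \<open>One criterion for everything built from \<open>f\<close> by scaling, by a smooth factor
  and by adding a Lipschitz term: an increment of \<open>F\<close> costs at most \<open>C\<close>
  increments of \<open>f\<close> and \<open>L\<close> times the length, and both are small on short
  families of intervals.\<close>

lemma abs_continuous_on_dominated:
  assumes f: "abs_continuous_on S f" and "0 \<le> C" "0 \<le> L"
    and le: "\<And>u v. u \<in> S \<Longrightarrow> v \<in> S \<Longrightarrow> u \<le> v \<Longrightarrow> \<bar>F v - F u\<bar> \<le> C * \<bar>f v - f u\<bar> + L * (v - u)"
  shows "abs_continuous_on S F"
  unfolding abs_continuous_on_def
proof (intro allI impI)
  fix e :: real assume e: "e > 0"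
  \<comment> \<open>The summand 1 in this denominator and in that of \<open>d'\<close> admits C = 0
    and L = 0; it also makes \<open>C * e'\<close> strictly smaller than e / 2.\<close>
  define e' where "e' = e / (2 * (C + 1))"
  have e': "e' > 0" using e \<open>0 \<le> C\<close> by (simp add: e'_def)
  obtain d where d: "d > 0" and
    D: "\<forall>D. D division_of \<Union>D \<and> \<Union>D \<subseteq> S \<and> (\<Sum>K\<in>D. Sup K - Inf K) < d
        \<longrightarrow> (\<Sum>K\<in>D. \<bar>f (Sup K) - f (Inf K)\<bar>) < e'"
    by (rule abs_continuous_onE[OF f e']) (rule that)
  define d' where "d' = min d (e / (2 * (L + 1)))"
  have "d' > 0" using d e \<open>0 \<le> L\<close> by (simp add: d'_def)
  moreover have "(\<Sum>K\<in>D. \<bar>F (Sup K) - F (Inf K)\<bar>) < e"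
    if H: "D division_of \<Union>D" "\<Union>D \<subseteq> S" "(\<Sum>K\<in>D. Sup K - Inf K) < d'" for D
  proof -
    have K: "Inf K \<in> S \<and> Sup K \<in> S \<and> Inf K \<le> Sup K" if KD: "K \<in> D" for K
    proof -
      obtain a b where ab: "K = cbox a b" "K \<noteq> {}"
        using division_ofD(3)[OF H(1) KD] division_ofD(4)[OF H(1) KD] by metis
      then have "a \<le> b" by simp
      with ab have "Inf K \<in> K" "Sup K \<in> K" "Inf K \<le> Sup K" by auto
      then show ?thesis using KD H(2) by blast
    qed
    have pos: "0 \<le> (\<Sum>K\<in>D. Sup K - Inf K)" using K by (intro sum_nonneg) auto
    have "(\<Sum>K\<in>D. \<bar>F (Sup K) - F (Inf K)\<bar>)
        \<le> (\<Sum>K\<in>D. C * \<bar>f (Sup K) - f (Inf K)\<bar> + L * (Sup K - Inf K))"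
      using K by (intro sum_mono le) auto
    also have "\<dots> = C * (\<Sum>K\<in>D. \<bar>f (Sup K) - f (Inf K)\<bar>) + L * (\<Sum>K\<in>D. Sup K - Inf K)"
      by (simp add: sum.distrib sum_distrib_left)
    also have "\<dots> \<le> C * e' + L * d'"
      using D[rule_format, of D] H \<open>0 \<le> C\<close> \<open>0 \<le> L\<close>
      by (intro add_mono mult_left_mono) (auto simp: d'_def)
    also have "\<dots> < e"
    proof -
      have "C * e' < e / 2" using e \<open>0 \<le> C\<close> by (simp add: e'_def field_simps)
      moreover have "L * d' \<le> L * (e / (2 * (L + 1)))"
        using \<open>0 \<le> L\<close> by (intro mult_left_mono) (auto simp: d'_def)
      moreover have "L * (e / (2 * (L + 1))) \<le> e / 2"
        using e \<open>0 \<le> L\<close> by (simp add: field_simps)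
      ultimately show ?thesis by linarith
    qed
    finally show ?thesis .
  qed
  ultimately show "\<exists>d>0. \<forall>D. D division_of \<Union>D \<and> \<Union>D \<subseteq> S \<and> (\<Sum>K\<in>D. Sup K - Inf K) < d
        \<longrightarrow> (\<Sum>K\<in>D. \<bar>F (Sup K) - F (Inf K)\<bar>) < e" by blast
qed

lemma abs_continuous_on_add:
  assumes f: "abs_continuous_on S f" and g: "abs_continuous_on S g"
  shows "abs_continuous_on S (\<lambda>t. f t + g t)"
  unfolding abs_continuous_on_def
proof (intro allI impI)
  fix e :: real assume "e > 0"
  then have e2: "e / 2 > 0" by simp
  obtain d1 where d1: "d1 > 0" and
    D1: "\<forall>D. D division_of \<Union>D \<and> \<Union>D \<subseteq> S \<and> (\<Sum>K\<in>D. Sup K - Inf K) < d1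
        \<longrightarrow> (\<Sum>K\<in>D. \<bar>f (Sup K) - f (Inf K)\<bar>) < e / 2"
    by (rule abs_continuous_onE[OF f e2]) (rule that)
  obtain d2 where d2: "d2 > 0" and
    D2: "\<forall>D. D division_of \<Union>D \<and> \<Union>D \<subseteq> S \<and> (\<Sum>K\<in>D. Sup K - Inf K) < d2
        \<longrightarrow> (\<Sum>K\<in>D. \<bar>g (Sup K) - g (Inf K)\<bar>) < e / 2"
    by (rule abs_continuous_onE[OF g e2]) (rule that)
  have "(\<Sum>K\<in>D. \<bar>f (Sup K) + g (Sup K) - (f (Inf K) + g (Inf K))\<bar>) < e"
    if "D division_of \<Union>D" "\<Union>D \<subseteq> S" "(\<Sum>K\<in>D. Sup K - Inf K) < min d1 d2" for D
  proof -
    have "(\<Sum>K\<in>D. \<bar>f (Sup K) + g (Sup K) - (f (Inf K) + g (Inf K))\<bar>)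
        \<le> (\<Sum>K\<in>D. \<bar>f (Sup K) - f (Inf K)\<bar> + \<bar>g (Sup K) - g (Inf K)\<bar>)"
      by (intro sum_mono) linarith
    then show ?thesis using D1[rule_format, of D] D2[rule_format, of D] that by (simp add: sum.distrib)
  qed
  then show "\<exists>d>0. \<forall>D. D division_of \<Union>D \<and> \<Union>D \<subseteq> S \<and> (\<Sum>K\<in>D. Sup K - Inf K) < d
        \<longrightarrow> (\<Sum>K\<in>D. \<bar>f (Sup K) + g (Sup K) - (f (Inf K) + g (Inf K))\<bar>) < e"
    using d1 d2 by (intro exI[of _ "min d1 d2"]) auto
qed

lemma abs_continuous_on_cmult:
  assumes "abs_continuous_on S f"
  shows "abs_continuous_on S (\<lambda>t. c * f t)"
  by (rule abs_continuous_on_dominated[OF assms, of "\<bar>c\<bar>" 0])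
     (auto simp: abs_mult right_diff_distrib[symmetric])

lemma abs_continuous_on_sum:
  assumes "\<And>i. i \<in> I \<Longrightarrow> abs_continuous_on S (f i)"
  shows "abs_continuous_on S (\<lambda>t. \<Sum>i\<in>I. f i t)"
  using assms
  by (induction I rule: infinite_finite_induct)
     (auto intro!: abs_continuous_on_const abs_continuous_on_add)

section \<open>Monotonicity and Gronwall's inequality under an almost everywhere derivative
  bound\<close>

text \<open>Two members of a division meet in a box with empty interior, hence in a null set, so
  measure is additive over them. This compares the total length of a family of intervals with the
  measure of an open set that contains them.\<close>

lemma lmeasurable_division:
  fixes D :: "'a::euclidean_space set set"
  assumes "D division_of S"
  shows "S \<in> lmeasurable" and "measure lebesgue S = (\<Sum>K\<in>D. measure lebesgue K)"
proof -
  have lm: "K \<in> lmeasurable" if "K \<in> D" for K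
    using division_ofD(4)[OF assms that] by auto
  have "pairwise (\<lambda>K L. negligible (K \<inter> L)) D"
    unfolding pairwise_def
  proof (intro ballI impI)
    fix K L assume KL: "K \<in> D" "L \<in> D" "K \<noteq> L"
    obtain a b where ab: "K = cbox a b" using division_ofD(4)[OF assms KL(1)] by blast
    obtain c d where cd: "L = cbox c d" using division_ofD(4)[OF assms KL(2)] by blast
    obtain u v where uv: "K \<inter> L = cbox u v" using ab cd Int_interval by blast
    have "interior (K \<inter> L) = {}" using division_ofD(5)[OF assms KL] by (simp add: interior_Int)
    then show "negligible (K \<inter> L)" unfolding uv interior_cbox negligible_interval .
  qed
  then show "measure lebesgue S = (\<Sum>K\<in>D. measure lebesgue K)"
    using measure_negligible_finite_Union[OF division_ofD(1)[OF assms] lm]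
      division_ofD(6)[OF assms] by simp
  show "S \<in> lmeasurable"
    using fmeasurable.finite_Union[OF division_ofD(1)[OF assms]] lm division_ofD(6)[OF assms] by blast
qed

text \<open>The exceptional null set is covered by an open set so small that absolute continuity
  controls the variation over the intervals tagged there; the other intervals of a fine tagged
  division are controlled by the sign of the derivative at their tag.\<close>

lemma abs_continuous_on_nonincreasing:
  fixes f :: "real \<Rightarrow> real"
  assumes "0 \<le> T" and ac: "abs_continuous_on {0..T} f"
    and deriv: "AE t in lebesgue. 0 \<le> t \<and> t \<le> T \<longrightarrow>
      (\<exists>D\<le>0. (f has_real_derivative D) (at t))"
  shows "f T \<le> f 0"
proof (rule field_le_epsilon)
  fix e :: real assume e: "e > 0"
  \<comment> \<open>The slope allowed on the well-behaved intervals: their total length is at most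
    T, so they contribute at most e / 2. The summand 1 covers T = 0.\<close>
  define e1 where "e1 = e / (2 * (T + 1))"
  have e1: "e1 > 0" using e \<open>0 \<le> T\<close> by (simp add: e1_def)
  have e2: "e / 2 > 0" using e by simp
  obtain d where d: "d > 0" and
    D: "\<forall>D. D division_of \<Union>D \<and> \<Union>D \<subseteq> {0..T} \<and> (\<Sum>K\<in>D. Sup K - Inf K) < d
        \<longrightarrow> (\<Sum>K\<in>D. \<bar>f (Sup K) - f (Inf K)\<bar>) < e / 2"
    by (rule abs_continuous_onE[OF ac e2]) (rule that)
  obtain N where N: "N \<in> null_sets lebesgue" and
    sub: "{t \<in> space lebesgue. \<not> (0 \<le> t \<and> t \<le> T \<longrightarrow>
      (\<exists>D\<le>0. (f has_real_derivative D) (at t)))} \<subseteq> N"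
    using deriv[unfolded eventually_ae_filter] ..
  have good: "\<exists>D\<le>0. (f has_real_derivative D) (at t)" if "t \<notin> N" "0 \<le> t \<and> t \<le> T" for t
    using sub that
    by (simp only: subset_iff mem_Collect_eq space_completion space_lborel space_borel UNIV_I simp_thms) fast
  have "N \<in> sets lebesgue" using N by (rule null_setsD2)
  then obtain U where U: "open U" "N \<subseteq> U" "U - N \<in> lmeasurable" "emeasure lebesgue (U - N) < ennreal d"
    using sets_lebesgue_outer_open d by meson
  have U_eq: "(U - N) \<union> N = U" using U(2) by blast
  have Ulm: "U \<in> lmeasurable"
    using fmeasurable.Un[OF U(3) fmeasurableI_null_sets[OF N]] unfolding U_eq .
  have "emeasure lebesgue U = emeasure lebesgue (U - N)"
    using emeasure_Un_null_set[OF fmeasurableD[OF U(3)] N] unfolding U_eq .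
  then have Ud: "measure lebesgue U < d"
    using U(4) emeasure_eq_measure2[OF Ulm] ennreal_less_iff[of "measure lebesgue U" d] by simp
  \<comment> \<open>Straddle estimate: the linear approximations at \<open>t\<close> to the left and
    to the right add up because \<open>t\<close> lies between \<open>u\<close> and \<open>v\<close>,
    and the linear part is nonpositive since D \<le> 0.\<close>
  have "\<exists>r>0. \<forall>u v. u \<le> t \<and> t \<le> v \<and> u \<in> ball t r \<and> v \<in> ball t r \<longrightarrow> f v - f u \<le> e1 * (v - u)"
    if t: "t \<notin> N" "0 \<le> t \<and> t \<le> T" for t
  proof -
    obtain D where D: "D \<le> 0" "(f has_real_derivative D) (at t)" using good[OF t] by blast
    then have "(f has_derivative (\<lambda>h. D * h)) (at t)" by (simp add: has_field_derivative_def)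
    then obtain r where r: "r > 0" "\<And>y. norm (y - t) < r \<Longrightarrow>
        norm (f y - f t - D * (y - t)) \<le> e1 * norm (y - t)"
      unfolding has_derivative_at_alt using e1 by metis
    have "f v - f u \<le> e1 * (v - u)"
      if "u \<le> t" "t \<le> v" "u \<in> ball t r" "v \<in> ball t r" for u v
    proof -
      have "\<bar>f v - f t - D * (v - t)\<bar> \<le> e1 * (v - t)" using r(2)[of v] that by (simp add: dist_real_def)
      moreover have "\<bar>f u - f t - D * (u - t)\<bar> \<le> e1 * (t - u)" using r(2)[of u] that by (simp add: dist_real_def)
      moreover have "D * (v - t) \<le> 0" "D * (u - t) \<ge> 0"
        using D(1) that by (auto simp: mult_nonpos_nonneg mult_nonpos_nonpos)
      ultimately show ?thesis by (simp add: algebra_simps abs_le_iff)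
    qed
    then show ?thesis using r(1) by blast
  qed
  then obtain r where r: "\<And>t. t \<notin> N \<Longrightarrow> 0 \<le> t \<and> t \<le> T \<Longrightarrow> r t > 0"
    "\<And>t u v. t \<notin> N \<Longrightarrow> 0 \<le> t \<and> t \<le> T \<Longrightarrow> u \<le> t \<Longrightarrow> t \<le> v \<Longrightarrow> u \<in> ball t (r t) \<Longrightarrow>
        v \<in> ball t (r t) \<Longrightarrow> f v - f u \<le> e1 * (v - u)"
    by metis
  \<comment> \<open>All points of \<open>N\<close> share the neighbourhood \<open>U\<close>. Tags
    lie in {0..T}, so the value outside is arbitrary.\<close>
  define g where "g t = (if t \<in> N then U else if 0 \<le> t \<and> t \<le> T then ball t (r t) else UNIV)" for t
  have "gauge g" unfolding gauge_def g_def using U r(1) by auto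
  then obtain p where p: "p tagged_division_of cbox 0 T" "g fine p"
    using fine_division_exists by blast
  note pp = tagged_division_ofD[OF p(1)]
  have K: "Inf K \<le> x \<and> x \<le> Sup K \<and> Inf K \<in> K \<and> Sup K \<in> K \<and> K = cbox (Inf K) (Sup K)
      \<and> K \<subseteq> g x \<and> 0 \<le> x \<and> x \<le> T" if xK: "(x, K) \<in> p" for x K
  proof -
    obtain a b where ab: "K = cbox a b" using pp(4)[OF xK] by blast
    have "x \<in> K" using pp(2)[OF xK] .
    then show ?thesis using ab pp(3)[OF xK] p(2) xK by (auto simp: fine_def)
  qed
  define p' where "p' = {(x, K) \<in> p. x \<in> N}"
  have p'p: "p' \<subseteq> p" by (auto simp: p'_def)
  have finp: "finite p" using pp(1) .
  have part: "p' tagged_partial_division_of cbox 0 T"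
    using p(1) p'p tagged_partial_division_subset unfolding tagged_division_of_def by blast
  define D' where "D' = snd ` p'"
  have D'div: "D' division_of \<Union>D'"
    unfolding D'_def using partial_division_of_tagged_division[OF part] .
  have D'T: "\<Union>D' \<subseteq> {0..T}"
    using pp(3) p'p by (fastforce simp: D'_def)
  have D'U: "\<Union>D' \<subseteq> U"
    using K p'p by (fastforce simp: D'_def p'_def g_def)
  \<comment> \<open>Absolute continuity speaks of sets of intervals, the division of tagged pairs.
    An interval can carry two different tags only if it is a single point, and there the summand is
    0.\<close>
  have sumD': "sum h D' = (\<Sum>(x, K)\<in>p'. h K)"
    if "\<And>a. h {a} = 0" for h :: "real set \<Rightarrow> real"
  proof -
    have inj: "h K = 0" if "(x, K) \<in> p'" "(y, K) \<in> p'" "x \<noteq> y" for x y K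
    proof -
      have "interior K \<inter> interior K = {}"
        using pp(5) that p'p by (metis Pair_inject subsetD)
      then have "box (Inf K) (Sup K) = {}" using K that(1) p'p
        by (metis Int_absorb interior_cbox subsetD)
      then have "Inf K = Sup K" using K[of x K] that(1) p'p by force
      then have "K = {Inf K}" using K[of x K] that(1) p'p by force
      then show ?thesis using \<open>\<And>a. h {a} = 0\<close> by metis
    qed
    have "sum h (snd ` p') = sum (h \<circ> snd) p'"
      using finp finite_subset[OF p'p] inj
      by (intro sum.reindex_nontrivial) (auto, blast)
    then show ?thesis by (simp add: D'_def case_prod_unfold)
  qed
  \<comment> \<open>By fineness the intervals tagged in \<open>N\<close> lie in \<open>U\<close>, so
    their total length is less than \<open>d\<close>.\<close>
  have "(\<Sum>K\<in>D'. Sup K - Inf K) = (\<Sum>K\<in>D'. measure lebesgue K)"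
  proof (rule sum.cong)
    fix K assume "K \<in> D'"
    then obtain x where "(x, K) \<in> p" using p'p by (auto simp: D'_def)
    from K[OF this] have "K = {Inf K..Sup K}" "Inf K \<le> Sup K" by auto
    then show "Sup K - Inf K = measure lebesgue K"
      by (metis content_real measure_completion borel_closed closed_atLeastAtMost sets_lborel)
  qed simp
  also have "\<dots> = measure lebesgue (\<Union>D')"
    using lmeasurable_division(2)[OF D'div] by simp
  also have "\<dots> \<le> measure lebesgue U"
    by (rule measure_mono_fmeasurable[OF D'U _ Ulm]) (use lmeasurable_division(1)[OF D'div] in blast)
  finally have "(\<Sum>K\<in>D'. \<bar>f (Sup K) - f (Inf K)\<bar>) < e / 2"
    using D[rule_format, of D'] D'div D'T Ud by simp
  then have "(\<Sum>(x, K)\<in>p'. \<bar>f (Sup K) - f (Inf K)\<bar>) < e / 2"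
    using sumD'[of "\<lambda>K. \<bar>f (Sup K) - f (Inf K)\<bar>"] by simp
  moreover have "(\<Sum>(x, K)\<in>p'. f (Sup K) - f (Inf K)) \<le> (\<Sum>(x, K)\<in>p'. \<bar>f (Sup K) - f (Inf K)\<bar>)"
    by (rule sum_mono) auto
  ultimately have bad: "(\<Sum>(x, K)\<in>p'. f (Sup K) - f (Inf K)) \<le> e / 2" by linarith
  have "(\<Sum>(x, K)\<in>p - p'. f (Sup K) - f (Inf K)) \<le> (\<Sum>(x, K)\<in>p - p'. e1 * (Sup K - Inf K))"
  proof (rule sum_mono, clarify)
    fix x K assume xK: "(x, K) \<in> p" "(x, K) \<notin> p'"
    then have "x \<notin> N" by (auto simp: p'_def)
    then show "f (Sup K) - f (Inf K) \<le> e1 * (Sup K - Inf K)"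
      using K[OF xK(1)] by (intro r(2)[of x]) (auto simp: g_def)
  qed
  also have "\<dots> \<le> (\<Sum>(x, K)\<in>p. e1 * (Sup K - Inf K))"
    using finp e1 K by (intro sum_mono2) (auto intro!: mult_nonneg_nonneg, fastforce)
  also have "\<dots> = e1 * T"
    using additive_tagged_division_1[of 0 T p "\<lambda>x. e1 * x"] p(1) \<open>0 \<le> T\<close>
    by (simp add: right_diff_distrib)
  also have "\<dots> \<le> e / 2" using \<open>0 \<le> T\<close> e by (simp add: e1_def field_simps)
  finally have "(\<Sum>(x, K)\<in>p - p'. f (Sup K) - f (Inf K)) \<le> e / 2" .
  moreover have "f T - f 0 = (\<Sum>(x, K)\<in>p. f (Sup K) - f (Inf K))"
    using additive_tagged_division_1[of 0 T p f] p(1) \<open>0 \<le> T\<close> by simp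
  ultimately show "f T \<le> f 0 + e"
    using bad sum.subset_diff[OF p'p finp, of "\<lambda>(x, K). f (Sup K) - f (Inf K)"] by linarith
qed

lemma abs_continuous_on_gronwall:
  fixes f :: "real \<Rightarrow> real"
  assumes "0 \<le> T" "0 \<le> a" "0 \<le> c" and ac: "abs_continuous_on {0..T} f"
    and bound: "\<And>t. 0 \<le> t \<Longrightarrow> t \<le> T \<Longrightarrow> \<bar>f t\<bar> \<le> B"
    and deriv: "AE t in lebesgue. 0 \<le> t \<and> t \<le> T \<longrightarrow>
      (\<exists>D\<le>- a * f t + c. (f has_real_derivative D) (at t))"
  shows "f T \<le> exp (- a * T) * f 0 + c * T"
proof -
  \<comment> \<open>The integrating factor, with the inhomogeneity overestimated by the constant
    \<open>c * exp (a * T)\<close>. Multiplication by \<open>exp (- a * T)\<close> then leaves the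
    plain error \<open>c * T\<close>, which suffices because \<open>c\<close> will tend to
    0.\<close>
  define F where "F t = exp (a * t) * f t - c * exp (a * T) * t" for t
  have "0 \<le> B" using bound[of 0] \<open>0 \<le> T\<close> by simp
  have "abs_continuous_on {0..T} F"
  proof (rule abs_continuous_on_dominated[OF ac])
    show "0 \<le> exp (a * T)" "0 \<le> B * a * exp (a * T) + c * exp (a * T)"
      using assms(1-3) \<open>0 \<le> B\<close> by auto
    fix u v assume uv: "u \<in> {0..T}" "v \<in> {0..T}" "u \<le> v"
    \<comment> \<open>Lipschitz bound for the exponential on [0, T]. In the product rule for
      increments below it meets the factor \<open>f u\<close>, and this is where the bound
      \<open>B\<close> enters.\<close>
    have "1 + (- a * (v - u)) \<le> exp (- a * (v - u))" by (rule exp_ge_add_one_self)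
    then have "exp (a * v) * (1 - exp (- a * (v - u))) \<le> exp (a * v) * (a * (v - u))"
      by (intro mult_left_mono) auto
    also have "\<dots> \<le> exp (a * T) * (a * (v - u))"
      using uv \<open>0 \<le> a\<close> by (intro mult_right_mono) (auto intro: mult_left_mono)
    also have "exp (a * v) * (1 - exp (- a * (v - u))) = exp (a * v) - exp (a * u)"
      by (simp add: right_diff_distrib flip: exp_add)
    finally have 1: "exp (a * v) - exp (a * u) \<le> exp (a * T) * (a * (v - u))" .
    have 2: "0 \<le> exp (a * v) - exp (a * u)" using uv \<open>0 \<le> a\<close> by (simp add: mult_left_mono)
    have "F v - F u = exp (a * v) * (f v - f u) + f u * (exp (a * v) - exp (a * u))
        - c * exp (a * T) * (v - u)"
      by (simp add: F_def algebra_simps)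
    then have "\<bar>F v - F u\<bar> \<le> \<bar>exp (a * v) * (f v - f u)\<bar> + \<bar>f u * (exp (a * v) - exp (a * u))\<bar>
        + \<bar>c * exp (a * T) * (v - u)\<bar>" by linarith
    also have "\<dots> = exp (a * v) * \<bar>f v - f u\<bar> + \<bar>f u\<bar> * (exp (a * v) - exp (a * u))
        + c * exp (a * T) * (v - u)"
      using 2 uv \<open>0 \<le> c\<close> by (simp add: abs_mult)
    also have "\<dots> \<le> exp (a * T) * \<bar>f v - f u\<bar> + B * (exp (a * T) * (a * (v - u)))
        + c * exp (a * T) * (v - u)"
      using uv \<open>0 \<le> a\<close> 1 2 bound[of u] \<open>0 \<le> B\<close>
      by (intro add_mono mult_right_mono mult_mono) (auto intro: mult_left_mono)
    finally show "\<bar>F v - F u\<bar> \<le> exp (a * T) * \<bar>f v - f u\<bar>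
        + (B * a * exp (a * T) + c * exp (a * T)) * (v - u)"
      by (simp add: algebra_simps)
  qed
  moreover have "AE t in lebesgue. 0 \<le> t \<and> t \<le> T \<longrightarrow>
      (\<exists>D\<le>0. (F has_real_derivative D) (at t))"
    using deriv
  proof eventually_elim
    case (elim t)
    show ?case
    proof
      assume t: "0 \<le> t \<and> t \<le> T"
      then obtain D where D: "D \<le> - a * f t + c" "(f has_real_derivative D) (at t)"
        using elim by blast
      have "(F has_real_derivative (exp (a * t) * a * f t + exp (a * t) * D - c * exp (a * T))) (at t)"
        unfolding F_def by (auto intro!: derivative_eq_intros D(2) simp: algebra_simps)
      moreover have "exp (a * t) * (a * f t + D) \<le> exp (a * T) * c"
        using t D(1) \<open>0 \<le> a\<close> \<open>0 \<le> c\<close>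
        by (intro order_trans[OF mult_left_mono[of _ c] mult_right_mono]) (auto intro: mult_left_mono)
      ultimately show "\<exists>D\<le>0. (F has_real_derivative D) (at t)"
        by (intro exI conjI) (auto simp: algebra_simps)
    qed
  qed
  ultimately have "F T \<le> F 0"
    using abs_continuous_on_nonincreasing \<open>0 \<le> T\<close> by blast
  then have "exp (- a * T) * F T \<le> exp (- a * T) * F 0" by (intro mult_left_mono) auto
  moreover have "exp (- a * T) * F T = f T - c * T"
    by (simp add: F_def right_diff_distrib mult.assoc[symmetric] mult.commute[of _ c] flip: exp_add)
  moreover have "F 0 = f 0" by (simp add: F_def)
  ultimately have "f T - c * T \<le> exp (- a * T) * f 0" by metis
  then show ?thesis by simp
qed

section \<open>The forward equation against truncated geometric weights\<close>

lemma finite_level: "finite {m :: nat^'d::finite. (\<Sum>i\<in>UNIV. m $ i) \<le> R}"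
proof (rule finite_subset)
  show "{m :: nat^'d. (\<Sum>i\<in>UNIV. m $ i) \<le> R} \<subseteq> vec_lambda ` (PiE UNIV (\<lambda>_. {..R}))"
  proof
    fix m :: "nat^'d" assume "m \<in> {m. (\<Sum>i\<in>UNIV. m $ i) \<le> R}"
    then have "m $ i \<le> R" for i
      using member_le_sum[of i UNIV "($) m"] by simp
    then have "($) m \<in> PiE UNIV (\<lambda>_. {..R})" by auto
    then show "m \<in> vec_lambda ` (PiE UNIV (\<lambda>_. {..R}))"
      by (metis image_eqI vec_nth_inverse)
  qed
qed (auto intro!: finite_imageI finite_PiE)

lemma add_diff_axis: "m $ i > 0 \<Longrightarrow> m - axis i 1 + axis i 1 = (m :: nat^'d::finite)"
  by (auto simp: vec_eq_iff axis_def)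

lemma diff_axis_0: "m $ i = 0 \<Longrightarrow> m - axis i 1 = (m :: nat^'d::finite)"
  by (auto simp: vec_eq_iff axis_def)

lemma sum_add_axis: "(\<Sum>k\<in>UNIV. (m + axis i 1) $ k) = Suc (\<Sum>k\<in>UNIV. (m :: nat^'d::finite) $ k)"
  by (simp add: sum.distrib axis_def)

lemma sum_diff_axis:
  "m $ i > 0 \<Longrightarrow> Suc (\<Sum>k\<in>UNIV. (m - axis i 1) $ k) = (\<Sum>k\<in>UNIV. (m :: nat^'d::finite) $ k)"
  using sum_add_axis[of "m - axis i 1" i] by (simp only: add_diff_axis)

text \<open>Summation by parts for births. Because \<open>B\<close> contains the support of
  \<open>w\<close> and the lower neighbours of the support, every term lost or gained at the edge of
  \<open>B\<close> has weight 0.\<close>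

lemma sum_shift_up:
  fixes w F :: "nat^'d::finite \<Rightarrow> real"
  assumes "finite B" "\<And>m. w m \<noteq> 0 \<Longrightarrow> m \<in> B"
    and down: "\<And>m. w m \<noteq> 0 \<Longrightarrow> m $ i > 0 \<Longrightarrow> m - axis i 1 \<in> B"
  shows "(\<Sum>m\<in>B. w m * (if m $ i > 0 then F (m - axis i 1) else 0)) = (\<Sum>m\<in>B. w (m + axis i 1) * F m)"
proof -
  have "(\<Sum>m\<in>B. w m * (if m $ i > 0 then F (m - axis i 1) else 0))
      = (\<Sum>m\<in>{m \<in> B. w m \<noteq> 0 \<and> m $ i > 0}. w m * F (m - axis i 1))"
    using assms(1) by (intro sum.mono_neutral_cong_right) auto
  also have "\<dots> = (\<Sum>m\<in>{m \<in> B. w (m + axis i 1) \<noteq> 0}. w (m + axis i 1) * F m)"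
    using assms(2,3)
    by (intro sum.reindex_bij_witness[of _ "\<lambda>m. m + axis i 1" "\<lambda>m. m - axis i 1"])
       (auto simp: add_diff_axis axis_nth simp del: One_nat_def)
  also have "\<dots> = (\<Sum>m\<in>B. w (m + axis i 1) * F m)"
    using assms(1) by (intro sum.mono_neutral_cong_left) auto
  finally show ?thesis .
qed

text \<open>Summation by parts for deaths. The vanishing of \<open>G\<close> at m_i = 0 is
  essential: subtraction truncates there, so m - e_i is m itself, and such an m is not reached by
  the shift.\<close>

lemma sum_shift_down:
  fixes w G :: "nat^'d::finite \<Rightarrow> real"
  assumes "finite B" "\<And>m. w m \<noteq> 0 \<Longrightarrow> m \<in> B"
    and up: "\<And>m. w m \<noteq> 0 \<Longrightarrow> m + axis i 1 \<in> B"
    and G: "\<And>m. m $ i = 0 \<Longrightarrow> G m = 0"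
  shows "(\<Sum>m\<in>B. w m * G (m + axis i 1)) = (\<Sum>m\<in>B. w (m - axis i 1) * G m)"
proof -
  have "(\<Sum>m\<in>B. w m * G (m + axis i 1)) = (\<Sum>m\<in>{m \<in> B. w m \<noteq> 0}. w m * G (m + axis i 1))"
    using assms(1) by (intro sum.mono_neutral_cong_right) auto
  also have "\<dots> = (\<Sum>m\<in>{m \<in> B. w (m - axis i 1) \<noteq> 0 \<and> m $ i > 0}. w (m - axis i 1) * G m)"
    using assms(2,3)
    by (intro sum.reindex_bij_witness[of _ "\<lambda>m. m - axis i 1" "\<lambda>m. m + axis i 1"])
       (auto simp: add_diff_axis axis_nth simp del: One_nat_def)
  also have "\<dots> = (\<Sum>m\<in>B. w (m - axis i 1) * G m)"
    using assms(1) G by (intro sum.mono_neutral_cong_left) auto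
  finally show ?thesis .
qed

text \<open>Duality: tested against a finitely supported weight, the forward operator becomes the
  backward generator acting on the weight, which can be estimated state by state.\<close>

lemma sum_weighted_forward_rhs:
  fixes w :: "nat^'d::finite \<Rightarrow> real"
  assumes "finite B" "\<And>m. w m \<noteq> 0 \<Longrightarrow> m \<in> B"
    and up: "\<And>m i. w m \<noteq> 0 \<Longrightarrow> m + axis i 1 \<in> B"
    and down: "\<And>m i. w m \<noteq> 0 \<Longrightarrow> m $ i > 0 \<Longrightarrow> m - axis i 1 \<in> B"
    and mu0: "\<And>i m. m $ i = 0 \<Longrightarrow> mu i m t = 0"
  shows "(\<Sum>m\<in>B. w m * forward_rhs lam mu t p m) = (\<Sum>m\<in>B. p m *
    (\<Sum>i\<in>UNIV. lam i m t * (w (m + axis i 1) - w m) + mu i m t * (w (m - axis i 1) - w m)))"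
proof -
  have 1: "(\<Sum>m\<in>B. w m * (\<Sum>i\<in>UNIV. if m $ i > 0 then lam i (m - axis i 1) t * p (m - axis i 1) else 0))
      = (\<Sum>m\<in>B. p m * (\<Sum>i\<in>UNIV. lam i m t * w (m + axis i 1)))"
  proof -
    have "(\<Sum>m\<in>B. w m * (\<Sum>i\<in>UNIV. if m $ i > 0 then lam i (m - axis i 1) t * p (m - axis i 1) else 0))
        = (\<Sum>i\<in>UNIV. \<Sum>m\<in>B. w m * (if m $ i > 0 then lam i (m - axis i 1) t * p (m - axis i 1) else 0))"
      unfolding sum_distrib_left by (rule sum.swap)
    also have "\<dots> = (\<Sum>i\<in>UNIV. \<Sum>m\<in>B. w (m + axis i 1) * (lam i m t * p m))"
      by (intro sum.cong refl sum_shift_up assms)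
    also have "\<dots> = (\<Sum>m\<in>B. \<Sum>i\<in>UNIV. w (m + axis i 1) * (lam i m t * p m))"
      by (rule sum.swap)
    finally show ?thesis by (simp add: sum_distrib_left mult_ac)
  qed
  have 2: "(\<Sum>m\<in>B. w m * (\<Sum>i\<in>UNIV. mu i (m + axis i 1) t * p (m + axis i 1)))
      = (\<Sum>m\<in>B. p m * (\<Sum>i\<in>UNIV. mu i m t * w (m - axis i 1)))"
  proof -
    have "(\<Sum>m\<in>B. w m * (\<Sum>i\<in>UNIV. mu i (m + axis i 1) t * p (m + axis i 1)))
        = (\<Sum>i\<in>UNIV. \<Sum>m\<in>B. w m * (mu i (m + axis i 1) t * p (m + axis i 1)))"
      unfolding sum_distrib_left by (rule sum.swap)
    also have "\<dots> = (\<Sum>i\<in>UNIV. \<Sum>m\<in>B. w (m - axis i 1) * (mu i m t * p m))"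
      using mu0 by (intro sum.cong refl sum_shift_down assms) auto
    also have "\<dots> = (\<Sum>m\<in>B. \<Sum>i\<in>UNIV. w (m - axis i 1) * (mu i m t * p m))"
      by (rule sum.swap)
    finally show ?thesis by (simp add: sum_distrib_left mult_ac)
  qed
  have "(\<Sum>m\<in>B. w m * forward_rhs lam mu t p m) =
      (\<Sum>m\<in>B. p m * (\<Sum>i\<in>UNIV. lam i m t * w (m + axis i 1)))
    + (\<Sum>m\<in>B. p m * (\<Sum>i\<in>UNIV. mu i m t * w (m - axis i 1)))
    - (\<Sum>m\<in>B. w m * ((\<Sum>i\<in>UNIV. lam i m t + mu i m t) * p m))"
    unfolding forward_rhs_def distrib_left right_diff_distrib sum.distrib sum_subtractf 1 2 ..
  also have "\<dots> = (\<Sum>m\<in>B. p m * ((\<Sum>i\<in>UNIV. lam i m t * w (m + axis i 1))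
      + (\<Sum>i\<in>UNIV. mu i m t * w (m - axis i 1)) - (\<Sum>i\<in>UNIV. lam i m t + mu i m t) * w m))"
    by (simp add: distrib_left right_diff_distrib sum.distrib sum_subtractf mult_ac)
  also have "\<dots> = (\<Sum>m\<in>B. p m *
    (\<Sum>i\<in>UNIV. lam i m t * (w (m + axis i 1) - w m) + mu i m t * (w (m - axis i 1) - w m)))"
    by (simp only: sum_distrib_right flip: sum.distrib sum_subtractf) (simp add: algebra_simps)
  finally show ?thesis .
qed

section \<open>Generator estimates for the geometric and the truncated weights\<close>

text \<open>A birth lowers the weight and a death raises it, so the worst rates are
  \<open>r\<^sup>2\<close> and \<open>s\<^sup>2\<close>. For n > 0 these give equality, since s =
  \<sigma> r turns both sides into - r^2 \<sigma>^n (1 - \<sigma>)^2. For n = 0 only births act,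
  with rate r (r - s), which is at least (r - s)^2. Square roots serve as parameters to make
  \<sigma> a plain quotient.\<close>

lemma geometric_generator_le:
  fixes r s l m :: real and n :: nat
  assumes "0 \<le> s" "s < r" "r\<^sup>2 \<le> l" "0 \<le> m" "m \<le> s\<^sup>2" and m0: "n = 0 \<Longrightarrow> m = 0"
  defines "\<sigma> \<equiv> s / r"
  shows "l * (\<sigma> ^ (n + 1) - \<sigma> ^ n) + m * (\<sigma> ^ (n - 1) - \<sigma> ^ n) \<le> - (r - s)\<^sup>2 * \<sigma> ^ n"
proof -
  have r: "r > 0" using assms by linarith
  have \<sigma>: "0 \<le> \<sigma>" "\<sigma> < 1" using assms r by (auto simp: \<sigma>_def)
  have \<sigma>r: "\<sigma> * r = s" using r by (simp add: \<sigma>_def)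
  have birth: "l * (\<sigma> - 1) \<le> r\<^sup>2 * (\<sigma> - 1)"
    using assms \<sigma> by (intro mult_right_mono_neg) auto
  show ?thesis
  proof (cases n)
    case 0
    have "r\<^sup>2 * (\<sigma> - 1) = r * s - r\<^sup>2" using \<sigma>r by (simp add: power2_eq_square algebra_simps)
    moreover have "s * s \<le> r * s" using assms by (intro mult_right_mono) auto
    moreover have "(r - s)\<^sup>2 = r\<^sup>2 - 2 * (r * s) + s * s"
      by (simp add: power2_eq_square algebra_simps)
    ultimately have "l * (\<sigma> - 1) \<le> - (r - s)\<^sup>2" using birth by linarith
    then show ?thesis using m0[OF 0] 0 by simp
  next
    case (Suc k)
    have "m * (1 - \<sigma>) \<le> s\<^sup>2 * (1 - \<sigma>)" using assms \<sigma> by (intro mult_right_mono) auto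
    moreover have "\<sigma> * (l * (\<sigma> - 1)) \<le> \<sigma> * (r\<^sup>2 * (\<sigma> - 1))"
      using birth \<sigma> by (intro mult_left_mono) auto
    ultimately have "\<sigma> * (l * (\<sigma> - 1)) + m * (1 - \<sigma>) \<le> \<sigma> * (r\<^sup>2 * (\<sigma> - 1)) + s\<^sup>2 * (1 - \<sigma>)"
      by linarith
    also have "\<dots> = - (r - s)\<^sup>2 * \<sigma>"
      unfolding \<sigma>r[symmetric] by (simp add: power2_eq_square algebra_simps)
    finally have "\<sigma> ^ k * (\<sigma> * (l * (\<sigma> - 1)) + m * (1 - \<sigma>)) \<le> \<sigma> ^ k * (- (r - s)\<^sup>2 * \<sigma>)"
      using \<sigma> by (intro mult_left_mono) auto
    then show ?thesis by (simp add: Suc algebra_simps)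
  qed
qed

text \<open>For R = 0 the quotient is 0 and the cut-off degenerates to the constant 1; finite
  support therefore requires 0 < R.\<close>

definition truncated_weight :: "real \<Rightarrow> 'd \<Rightarrow> nat \<Rightarrow> nat^'d::finite \<Rightarrow> real" where
  "truncated_weight \<sigma> j R m = \<sigma> ^ (m $ j) * max 0 (1 - real (\<Sum>i\<in>UNIV. m $ i) / real R)"

lemma truncated_weight_bounds:
  assumes "0 \<le> \<sigma>" "\<sigma> \<le> 1"
  shows "0 \<le> truncated_weight \<sigma> j R m" "truncated_weight \<sigma> j R m \<le> \<sigma> ^ (m $ j)"
    "truncated_weight \<sigma> j R m \<le> 1"
proof -
  show "0 \<le> truncated_weight \<sigma> j R m" using assms by (simp add: truncated_weight_def)
  show *: "truncated_weight \<sigma> j R m \<le> \<sigma> ^ (m $ j)"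
    unfolding truncated_weight_def using assms
    by (intro mult_left_le) (auto intro!: divide_nonneg_nonneg sum_nonneg)
  show "truncated_weight \<sigma> j R m \<le> 1"
    using * power_le_one[OF assms, of "m $ j"] by linarith
qed

lemma truncated_weight_support:
  assumes "0 < R" "truncated_weight \<sigma> j R m \<noteq> 0"
  shows "(\<Sum>i\<in>UNIV. m $ i) < R"
proof (rule ccontr)
  assume "\<not> (\<Sum>i\<in>UNIV. m $ i) < R"
  then have "1 \<le> real (\<Sum>i\<in>UNIV. m $ i) / real R"
    using assms(1) by (simp only: le_divide_eq of_nat_0_less_iff if_True not_less mult_1 of_nat_le_iff)
  then show False using assms(2) by (simp add: truncated_weight_def)
qed

text \<open>Splitting each change of the product into a change of the geometric factor and one of
  the cut-off leaves the geometric estimate for i = j and nothing for i \<noteq> j. The change of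
  the cut-off helps at a birth and costs at most 1/R at a death, hence at most M/R for each of the
  CARD('d) types.\<close>

lemma truncated_weight_generator_le:
  fixes m :: "nat^'d::finite"
  assumes "0 \<le> s" "s < r" "0 < R"
    and nonneg: "\<And>i. 0 \<le> l i" "\<And>i. 0 \<le> u i" and u: "\<And>i. u i \<le> M"
    and u0: "\<And>i. m $ i = 0 \<Longrightarrow> u i = 0"
    and j: "r\<^sup>2 \<le> l j" "u j \<le> s\<^sup>2"
  defines "w \<equiv> truncated_weight (s / r) j R"
  shows "(\<Sum>i\<in>UNIV. l i * (w (m + axis i 1) - w m) + u i * (w (m - axis i 1) - w m))
    \<le> - (r - s)\<^sup>2 * w m + real CARD('d) * M / real R"
proof -
  define \<sigma> where "\<sigma> = s / r"
  define g where "g m = max 0 (1 - real (\<Sum>i\<in>UNIV. m $ i) / real R)" for m :: "nat^'d"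
  have \<sigma>: "0 \<le> \<sigma>" "\<sigma> < 1" using assms by (auto simp: \<sigma>_def)
  have w: "w m = \<sigma> ^ (m $ j) * g m" for m
    by (simp add: w_def truncated_weight_def \<sigma>_def g_def)
  have g0: "0 \<le> g m" for m by (simp add: g_def)
  have g_up: "g (m + axis i 1) \<le> g m" for i
    unfolding g_def sum_add_axis by (intro max.mono diff_left_mono divide_right_mono) auto
  have g_down: "g (m - axis i 1) \<le> g m + 1 / real R" for i
  proof (cases "m $ i > 0")
    case True
    have "real (\<Sum>k\<in>UNIV. m $ k) = real (\<Sum>k\<in>UNIV. (m - axis i 1) $ k) + 1"
      using sum_diff_axis[OF True] by linarith
    then show ?thesis by (simp only: g_def add_divide_distrib) (simp add: max_def)
  \<comment> \<open>Without particles of type i the truncated difference is m itself, so the cut-off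
    does not change.\<close>
  qed (simp add: diff_axis_0 del: One_nat_def)
  have up: "w (m + axis i 1) - w m \<le> g m * (\<sigma> ^ ((m + axis i 1) $ j) - \<sigma> ^ (m $ j))" for i
    using mult_left_mono[OF g_up, of "\<sigma> ^ ((m + axis i 1) $ j)" i] \<sigma>
    by (simp add: w algebra_simps)
  have down: "w (m - axis i 1) - w m
      \<le> g m * (\<sigma> ^ ((m - axis i 1) $ j) - \<sigma> ^ (m $ j)) + 1 / real R" for i
  proof -
    have "\<sigma> ^ ((m - axis i 1) $ j) * g (m - axis i 1)
        \<le> \<sigma> ^ ((m - axis i 1) $ j) * g m + \<sigma> ^ ((m - axis i 1) $ j) * (1 / real R)"
      using mult_left_mono[OF g_down, of "\<sigma> ^ ((m - axis i 1) $ j)" i] \<sigma>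
      by (simp add: distrib_left)
    moreover have "\<sigma> ^ ((m - axis i 1) $ j) * (1 / real R) \<le> 1 / real R"
      using \<sigma> by (intro mult_left_le_one_le) (auto intro: power_le_one)
    ultimately show ?thesis by (simp add: w algebra_simps)
  qed
  have term_le: "l i * (w (m + axis i 1) - w m) + u i * (w (m - axis i 1) - w m)
      \<le> (if i = j then - (r - s)\<^sup>2 * w m else 0) + M / real R" for i
  proof -
    have "l i * (w (m + axis i 1) - w m) + u i * (w (m - axis i 1) - w m)
        \<le> l i * (g m * (\<sigma> ^ ((m + axis i 1) $ j) - \<sigma> ^ (m $ j)))
          + u i * (g m * (\<sigma> ^ ((m - axis i 1) $ j) - \<sigma> ^ (m $ j)) + 1 / real R)"
      by (intro add_mono mult_left_mono up down nonneg)
    also have "\<dots> = g m * (l i * (\<sigma> ^ ((m + axis i 1) $ j) - \<sigma> ^ (m $ j))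
          + u i * (\<sigma> ^ ((m - axis i 1) $ j) - \<sigma> ^ (m $ j))) + u i / real R"
      by (simp add: algebra_simps)
    also have "\<dots> \<le> (if i = j then - (r - s)\<^sup>2 * w m else 0) + M / real R"
    proof (rule add_mono)
      show "u i / real R \<le> M / real R" using u by (intro divide_right_mono) auto
      show "g m * (l i * (\<sigma> ^ ((m + axis i 1) $ j) - \<sigma> ^ (m $ j))
          + u i * (\<sigma> ^ ((m - axis i 1) $ j) - \<sigma> ^ (m $ j)))
          \<le> (if i = j then - (r - s)\<^sup>2 * w m else 0)"
      proof (cases "i = j")
        case True
        have "l j * (\<sigma> ^ (m $ j + 1) - \<sigma> ^ (m $ j)) + u j * (\<sigma> ^ (m $ j - 1) - \<sigma> ^ (m $ j))
            \<le> - (r - s)\<^sup>2 * \<sigma> ^ (m $ j)"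
          unfolding \<sigma>_def using assms(1,2) j nonneg u0 by (intro geometric_generator_le) auto
        from mult_left_mono[OF this g0[of m]] show ?thesis
          using True by (simp add: axis_def w mult_ac)
      qed (simp add: axis_def)
    qed
    finally show ?thesis .
  qed
  have "(\<Sum>i\<in>UNIV. l i * (w (m + axis i 1) - w m) + u i * (w (m - axis i 1) - w m))
      \<le> (\<Sum>i\<in>UNIV. (if i = j then - (r - s)\<^sup>2 * w m else 0) + M / real R)"
    by (intro sum_mono term_le)
  also have "\<dots> = - (r - s)\<^sup>2 * w m + real CARD('d) * M / real R"
    by (simp add: sum.distrib)
  finally show ?thesis .
qed

section \<open>Decay of weighted sums along a forward solution\<close>

text \<open>The weighted sum is finite, so it is absolutely continuous and may be differentiated
  termwise. Since the total mass is at most 1, the generator error per state is also the error for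
  the whole sum, and Gronwall's inequality applies.\<close>

lemma forward_solution_truncated_decay:
  fixes lam mu :: "'d::finite \<Rightarrow> nat^'d \<Rightarrow> real \<Rightarrow> real"
  assumes sol: "forward_solution lam mu p"
    and p: "\<And>t m. 0 \<le> t \<Longrightarrow> 0 \<le> p t m" "\<And>t F. 0 \<le> t \<Longrightarrow> finite F \<Longrightarrow> sum (p t) F \<le> 1"
    and nonneg: "\<And>i m t. 0 \<le> t \<Longrightarrow> 0 \<le> lam i m t" "\<And>i m t. 0 \<le> t \<Longrightarrow> 0 \<le> mu i m t"
    and no_death: "\<And>i m t. 0 \<le> t \<Longrightarrow> m $ i = 0 \<Longrightarrow> mu i m t = 0"
    and M: "\<And>i m. AE t in lebesgue. 0 \<le> t \<longrightarrow> mu i m t \<le> M" "0 \<le> M"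
    and birth: "\<And>m t. 0 \<le> t \<Longrightarrow> r\<^sup>2 \<le> lam j m t"
    and death: "\<And>m t. 0 \<le> t \<Longrightarrow> 1 \<le> m $ j \<Longrightarrow> mu j m t \<le> s\<^sup>2"
    and "0 \<le> s" "s < r" "0 < R" "0 \<le> T"
  defines "w \<equiv> truncated_weight (s / r) j R"
    and "B \<equiv> {m. (\<Sum>i\<in>UNIV. m $ i) \<le> R}"
  shows "(\<Sum>m\<in>B. w m * p T m)
    \<le> exp (- (r - s)\<^sup>2 * T) * (\<Sum>m\<in>B. w m * p 0 m) + real CARD('d) * M / real R * T"
proof -
  have "0 \<le> s / r" "s / r \<le> 1" using assms by auto
  note w01 = truncated_weight_bounds[OF this, of j R, folded w_def]
  note supp = truncated_weight_support[OF \<open>0 < R\<close>, of "s / r" j, folded w_def]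
  have finB: "finite B" unfolding B_def by (rule finite_level)
  have B: "m \<in> B" "m + axis i 1 \<in> B" "m $ i > 0 \<Longrightarrow> m - axis i 1 \<in> B" if "w m \<noteq> 0" for m i
    using supp[OF that] sum_add_axis[of m i] sum_diff_axis[of m i]
    by (auto simp: B_def simp del: vector_add_component vector_minus_component)
  define C where "C = real CARD('d) * M / real R"
  have C0: "0 \<le> C" using M(2) by (simp add: C_def)
  define W where "W t = (\<Sum>m\<in>B. w m * p t m)" for t
  have ac: "abs_continuous_on {0..T} W"
    unfolding W_def using sol \<open>0 \<le> T\<close>
    by (intro abs_continuous_on_sum abs_continuous_on_cmult) (simp add: forward_solution_def)
  have bound: "\<bar>W t\<bar> \<le> 1" if "0 \<le> t" for t
  proof -
    have "W t \<le> sum (p t) B"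
      unfolding W_def using w01 p(1)[OF that] by (intro sum_mono mult_left_le_one_le) auto
    moreover have "0 \<le> W t" unfolding W_def using w01 p(1)[OF that] by (intro sum_nonneg) auto
    ultimately show ?thesis using p(2)[OF that finB] by linarith
  qed
  \<comment> \<open>States are countable, so the exceptional null sets of the single equations, and
    likewise those of the intensity bounds, merge into one.\<close>
  have "AE t in lebesgue. \<forall>m. 0 \<le> t \<longrightarrow>
      ((\<lambda>s. p s m) has_real_derivative forward_rhs lam mu t (p t) m) (at t)"
    unfolding AE_all_countable using sol by (simp add: forward_solution_def)
  moreover have "AE t in lebesgue. \<forall>i m. 0 \<le> t \<longrightarrow> mu i m t \<le> M"
    unfolding AE_all_countable using M(1) by blast
  ultimately have "AE t in lebesgue. 0 \<le> t \<and> t \<le> T \<longrightarrow>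
      (\<exists>D\<le>- (r - s)\<^sup>2 * W t + C. (W has_real_derivative D) (at t))"
  proof eventually_elim
    case (elim t)
    show ?case
    proof
      assume t: "0 \<le> t \<and> t \<le> T"
      let ?D = "\<Sum>m\<in>B. w m * forward_rhs lam mu t (p t) m"
      have "(W has_real_derivative ?D) (at t)"
        unfolding W_def using elim(1) t by (intro DERIV_sum DERIV_cmult) auto
      moreover have "?D \<le> - (r - s)\<^sup>2 * W t + C"
      proof -
        have "?D = (\<Sum>m\<in>B. p t m * (\<Sum>i\<in>UNIV. lam i m t * (w (m + axis i 1) - w m)
            + mu i m t * (w (m - axis i 1) - w m)))"
          by (intro sum_weighted_forward_rhs finB) (use B no_death t in auto)
        also have "\<dots> \<le> (\<Sum>m\<in>B. p t m * (- (r - s)\<^sup>2 * w m + C))"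
        proof (intro sum_mono mult_left_mono)
          fix m
          \<comment> \<open>The death bound is assumed only where m_j is at least 1; at m_j = 0 the
            intensity is 0.\<close>
          have "mu j m t \<le> s\<^sup>2" using death[of t m] no_death[of t m j] t by (cases "m $ j") auto
          then show "(\<Sum>i\<in>UNIV. lam i m t * (w (m + axis i 1) - w m)
              + mu i m t * (w (m - axis i 1) - w m)) \<le> - (r - s)\<^sup>2 * w m + C"
            unfolding w_def C_def using assms(9-11) elim(2) t nonneg no_death birth \<open>s < r\<close> \<open>0 < R\<close>
            by (intro truncated_weight_generator_le) auto
        qed (use p(1) t in auto)
        also have "\<dots> = - (r - s)\<^sup>2 * W t + C * sum (p t) B"
          unfolding W_def sum_distrib_left by (simp add: algebra_simps sum.distrib sum_subtractf sum_negf)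
        also have "\<dots> \<le> - (r - s)\<^sup>2 * W t + C * 1"
          using C0 p(2)[of t B] finB t by (intro add_left_mono mult_left_mono) auto
        finally show ?thesis by simp
      qed
      ultimately show "\<exists>D\<le>- (r - s)\<^sup>2 * W t + C. (W has_real_derivative D) (at t)" by blast
    qed
  qed
  from abs_continuous_on_gronwall[OF \<open>0 \<le> T\<close> zero_le_power2 C0 ac bound this]
  show ?thesis by (simp add: W_def C_def)
qed

text \<open>The limit R \<rightarrow> \<infinity> is taken on a fixed finite set \<open>F\<close> of
  states, where the cut-off tends to 1. Stating the initial weighted mass as a bound
  \<open>V\<close> on all finite partial sums avoids infinite sums at this stage.\<close>

lemma forward_solution_weighted_decay:
  fixes lam mu :: "'d::finite \<Rightarrow> nat^'d \<Rightarrow> real \<Rightarrow> real"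
  assumes sol: "forward_solution lam mu p"
    and p: "\<And>t m. 0 \<le> t \<Longrightarrow> 0 \<le> p t m" "\<And>t F. 0 \<le> t \<Longrightarrow> finite F \<Longrightarrow> sum (p t) F \<le> 1"
    and nonneg: "\<And>i m t. 0 \<le> t \<Longrightarrow> 0 \<le> lam i m t" "\<And>i m t. 0 \<le> t \<Longrightarrow> 0 \<le> mu i m t"
    and no_death: "\<And>i m t. 0 \<le> t \<Longrightarrow> m $ i = 0 \<Longrightarrow> mu i m t = 0"
    and M: "\<And>i m. AE t in lebesgue. 0 \<le> t \<longrightarrow> mu i m t \<le> M" "0 \<le> M"
    and birth: "\<And>m t. 0 \<le> t \<Longrightarrow> r\<^sup>2 \<le> lam j m t"
    and death: "\<And>m t. 0 \<le> t \<Longrightarrow> 1 \<le> m $ j \<Longrightarrow> mu j m t \<le> s\<^sup>2"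
    and sr: "0 \<le> s" "s < r" and "0 \<le> T" "finite F"
    and V: "\<And>G. finite G \<Longrightarrow> (\<Sum>m\<in>G. (s / r) ^ (m $ j) * p 0 m) \<le> V"
  shows "(\<Sum>m\<in>F. (s / r) ^ (m $ j) * p T m) \<le> exp (- (r - s)\<^sup>2 * T) * V"
proof (rule LIMSEQ_le)
  let ?w = "\<lambda>R. truncated_weight (s / r) j (Suc R)"
  let ?C = "real CARD('d) * M * T"
  have \<sigma>: "0 \<le> s / r" "s / r \<le> 1" using sr by auto
  have inv: "(\<lambda>R. c / real (Suc R)) \<longlonglongrightarrow> 0" for c
    using tendsto_mult_right_zero[OF LIMSEQ_inverse_real_of_nat, of c] by (simp add: divide_inverse)
  show "(\<lambda>R. \<Sum>m\<in>F. ?w R m * p T m) \<longlonglongrightarrow> (\<Sum>m\<in>F. (s / r) ^ (m $ j) * p T m)"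
  proof (intro tendsto_sum tendsto_mult tendsto_const)
    fix m
    have "(\<lambda>R. (s / r) ^ (m $ j) * max 0 (1 - real (\<Sum>i\<in>UNIV. m $ i) / real (Suc R)))
        \<longlonglongrightarrow> (s / r) ^ (m $ j) * max 0 (1 - 0)"
      by (intro tendsto_mult tendsto_max tendsto_diff tendsto_const inv)
    then show "(\<lambda>R. ?w R m) \<longlonglongrightarrow> (s / r) ^ (m $ j)" by (simp add: truncated_weight_def)
  qed
  have "(\<lambda>R. exp (- (r - s)\<^sup>2 * T) * V + ?C / real (Suc R)) \<longlonglongrightarrow> exp (- (r - s)\<^sup>2 * T) * V + 0"
    by (intro tendsto_add tendsto_const inv)
  then show "(\<lambda>R. exp (- (r - s)\<^sup>2 * T) * V + ?C / real (Suc R)) \<longlonglongrightarrow> exp (- (r - s)\<^sup>2 * T) * V"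
    by simp
  show "\<exists>N. \<forall>R\<ge>N. (\<Sum>m\<in>F. ?w R m * p T m) \<le> exp (- (r - s)\<^sup>2 * T) * V + ?C / real (Suc R)"
  proof (intro exI allI impI)
    fix R :: nat
    let ?B = "{m :: nat^'d. (\<Sum>i\<in>UNIV. m $ i) \<le> Suc R}"
    have fin: "finite ?B" by (rule finite_level)
    have w0: "?w R m = 0" if "m \<notin> ?B" for m
      using truncated_weight_support[of "Suc R" "s / r" j m] that by fastforce
    \<comment> \<open>\<open>F\<close> need not lie inside the support of the cut-off. Adding the
      missing states of \<open>?B\<close> only increases the sum, and those of \<open>F\<close>
      outside \<open>?B\<close> have weight 0.\<close>
    have "(\<Sum>m\<in>F. ?w R m * p T m) \<le> (\<Sum>m\<in>F \<union> ?B. ?w R m * p T m)"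
      using \<open>finite F\<close> fin truncated_weight_bounds(1)[OF \<sigma>, of j] p(1)[OF \<open>0 \<le> T\<close>]
      by (intro sum_mono2) (auto intro: mult_nonneg_nonneg)
    also have "\<dots> = (\<Sum>m\<in>?B. ?w R m * p T m)"
      using \<open>finite F\<close> fin w0 by (intro sum.mono_neutral_right) auto
    also have "\<dots> \<le> exp (- (r - s)\<^sup>2 * T) * (\<Sum>m\<in>?B. ?w R m * p 0 m)
        + real CARD('d) * M / real (Suc R) * T"
      by (rule forward_solution_truncated_decay[OF sol p nonneg no_death M birth death sr])
         (use \<open>0 \<le> T\<close> in auto)
    also have "(\<Sum>m\<in>?B. ?w R m * p 0 m) \<le> (\<Sum>m\<in>?B. (s / r) ^ (m $ j) * p 0 m)"
      using p(1)[of 0] truncated_weight_bounds(2)[OF \<sigma>] by (intro sum_mono mult_right_mono) auto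
    also have "\<dots> \<le> V" by (rule V[OF fin])
    finally show "(\<Sum>m\<in>F. ?w R m * p T m) \<le> exp (- (r - s)\<^sup>2 * T) * V + ?C / real (Suc R)"
      by simp
  qed
qed

section \<open>Laws of the process\<close>

text \<open>On a countable type the point masses determine a law. With the law as a pmf, statements
  on the abstract probability space become computations with pmfs.\<close>

lemma (in prob_space) countable_law_pmf:
  fixes Y :: "'a \<Rightarrow> 'b::countable"
  assumes Y: "Y \<in> measurable M (count_space UNIV)"
  obtains q where "\<And>A. \<P>(w in M. Y w \<in> A) = measure_pmf.prob q A"
proof -
  define N where "N = distr M (count_space UNIV) Y"
  interpret N: prob_space N unfolding N_def by (rule prob_space_distr[OF Y])
  have sets_N: "sets N = UNIV" and space_N: "space N = UNIV" by (simp_all add: N_def)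
  have pos: "0 \<le> measure N {x}" for x by simp
  have total: "(\<integral>\<^sup>+x. ennreal (measure N {x}) \<partial>count_space UNIV) = 1"
    using emeasure_countable_singleton[of UNIV N] N.emeasure_space_1
    by (simp add: sets_N space_N N.emeasure_eq_measure)
  define q where "q = embed_pmf (\<lambda>x. measure N {x})"
  have "emeasure N {x} = emeasure (measure_pmf q) {x}" for x
    using pmf_embed_pmf[OF pos total, of x]
    by (simp add: q_def N.emeasure_eq_measure emeasure_pmf_single)
  then have "N = measure_pmf q"
    by (intro measure_eqI_countable[where A = UNIV]) (auto simp: sets_N)
  have "\<P>(w in M. Y w \<in> A) = measure_pmf.prob q A" for A
  proof -
    have "\<P>(w in M. Y w \<in> A) = measure N A"
      unfolding N_def by (subst measure_distr[OF Y]) (auto intro!: arg_cong[where f = prob])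
    then show ?thesis by (simp only: \<open>N = measure_pmf q\<close>)
  qed
  then show ?thesis by (rule that)
qed

text \<open>The bridge between integrals and the finite sums over states: \<open>has_sum\<close>
  allows comparison with partial sums in both directions.\<close>

lemma pmf_expectation_has_sum:
  fixes g :: "'a \<Rightarrow> real"
  assumes "\<And>x. \<bar>g x\<bar> \<le> B"
  shows "((\<lambda>x. g x * pmf q x) has_sum measure_pmf.expectation q g) UNIV"
proof -
  have sm: "Infinite_Set_Sum.abs_summable_on (\<lambda>x. g x * pmf q x) UNIV"
    by (rule abs_summable_on_comparison_test'[OF abs_summable_on_cmult_right[where c = B, OF pmf_abs_summable[of q]]])
       (use assms in \<open>auto simp: abs_mult intro!: mult_right_mono\<close>)
  have "measure_pmf.expectation q g = infsum (\<lambda>x. g x * pmf q x) UNIV"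
    unfolding infsetsum_infsum[OF sm, symmetric] pmf_expectation_eq_infsetsum
    by (simp add: mult.commute)
  moreover have "(\<lambda>x. g x * pmf q x) summable_on UNIV"
    using abs_summable_summable abs_summable_equivalent sm by blast
  ultimately show ?thesis by (simp add: has_sum_infsum)
qed

lemma l1_norm_weighted_marginal:
  fixes h :: "'a \<Rightarrow> nat"
  assumes "0 \<le> \<sigma>" "\<sigma> \<le> 1"
  shows "l1_norm (\<lambda>n. \<sigma> ^ n * measure_pmf.prob q {m. h m = n})
    = measure_pmf.expectation q (\<lambda>m. \<sigma> ^ h m)"
proof -
  have "((\<lambda>n. \<sigma> ^ n * pmf (map_pmf h q) n) has_sum
      measure_pmf.expectation (map_pmf h q) (\<lambda>n. \<sigma> ^ n)) UNIV"
    by (rule pmf_expectation_has_sum[where B = 1]) (use assms in \<open>simp add: power_le_one\<close>)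
  then have "infsum (\<lambda>n. \<sigma> ^ n * pmf (map_pmf h q) n) UNIV = measure_pmf.expectation q (\<lambda>m. \<sigma> ^ h m)"
    by (simp add: infsumI)
  moreover have "pmf (map_pmf h q) n = measure_pmf.prob q {m. h m = n}" for n
    by (simp add: pmf_map vimage_def)
  ultimately show ?thesis using assms by (simp add: l1_norm_def abs_mult)
qed

section \<open>Decay and tail bounds for the process\<close>

context birth_death_process
begin

text \<open>The law at time t enters as an arbitrary pmf \<open>q\<close> with the right point
  masses, so that the estimate serves both a general initial distribution and the kernel
  \<open>P 0 t a\<close>.\<close>

lemma weighted_expectation_decay:
  assumes birth: "\<And>m t. 0 \<le> t \<Longrightarrow> l \<le> lam j m t"
    and death: "\<And>m t. 0 \<le> t \<Longrightarrow> 1 \<le> m $ j \<Longrightarrow> mu j m t \<le> u"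
    and "0 \<le> u" "u < l" "0 \<le> t"
    and q: "\<And>m. \<P>(w in Pr p0. X t w = m) = pmf q m"
  shows "measure_pmf.expectation q (\<lambda>m. sqrt (u / l) ^ (m $ j))
    \<le> exp (- (sqrt l - sqrt u)\<^sup>2 * t) * measure_pmf.expectation p0 (\<lambda>m. sqrt (u / l) ^ (m $ j))"
proof -
  define p where "p t m = \<P>(w in Pr p0. X t w = m)" for t m
  have \<sigma>: "0 \<le> sqrt (u / l)" "sqrt (u / l) \<le> 1" using assms by auto
  have \<sigma>_eq: "sqrt (u / l) = sqrt u / sqrt l" by (rule real_sqrt_divide)
  have hs: "((\<lambda>m. sqrt (u / l) ^ (m $ j) * pmf q' m) has_sum
      measure_pmf.expectation q' (\<lambda>m. sqrt (u / l) ^ (m $ j))) UNIV" for q' :: "(nat^'d) pmf"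
    by (rule pmf_expectation_has_sum[where B = 1]) (use \<sigma> in \<open>simp add: power_le_one\<close>)
  obtain M0 where M0: "\<And>i m. AE t in lebesgue. 0 \<le> t \<longrightarrow> mu i m t \<le> M0"
    using intensity_bounded(2) by blast
  \<comment> \<open>The essential bound is not known to be nonnegative, whereas the error term of
    the truncation must be.\<close>
  define M where "M = max M0 0"
  have M: "AE t in lebesgue. 0 \<le> t \<longrightarrow> mu i m t \<le> M" for i m
    using M0[of i m] by eventually_elim (auto simp: M_def)
  have sum_p: "sum (p t) F \<le> 1" if t: "0 \<le> t" and F: "finite F" for t F
  proof -
    interpret prob_space "Pr p0" by (rule prob_space)
    obtain r where r: "\<And>A. \<P>(w in Pr p0. X t w \<in> A) = measure_pmf.prob r A"
      using countable_law_pmf[OF measurable[OF t]] by blast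
    have "p t m = pmf r m" for m using r[of "{m}"] by (simp add: p_def measure_pmf_single)
    then have "sum (p t) F = measure_pmf.prob r F" using F by (simp add: measure_measure_pmf_finite)
    then show ?thesis by simp
  qed
  show ?thesis
  proof (rule has_sum_le_finite_sums[OF hs])
    fix F :: "(nat^'d) set" assume "finite F"
    have "(\<Sum>m\<in>F. (sqrt u / sqrt l) ^ (m $ j) * p t m) \<le> exp (- (sqrt l - sqrt u)\<^sup>2 * t)
        * measure_pmf.expectation p0 (\<lambda>m. sqrt (u / l) ^ (m $ j))"
    proof (rule forward_solution_weighted_decay[where lam = lam and mu = mu and M = M])
      show "forward_solution lam mu p" unfolding p_def[abs_def] by (rule forward_kolmogorov)
      show "(\<Sum>m\<in>G. (sqrt u / sqrt l) ^ (m $ j) * p 0 m)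
          \<le> measure_pmf.expectation p0 (\<lambda>m. sqrt (u / l) ^ (m $ j))" if "finite G" for G
        unfolding p_def initial \<sigma>_eq[symmetric]
        by (rule finite_sum_le_has_sum[OF hs that]) (use \<sigma> in auto)
    qed (use assms M \<open>finite F\<close> intensity_nonneg no_death sum_p in \<open>auto simp: M_def p_def\<close>)
    then show "(\<Sum>m\<in>F. sqrt (u / l) ^ (m $ j) * pmf q m) \<le> exp (- (sqrt l - sqrt u)\<^sup>2 * t)
        * measure_pmf.expectation p0 (\<lambda>m. sqrt (u / l) ^ (m $ j))"
      by (simp add: p_def q \<sigma>_eq)
  qed
qed

text \<open>Grouping the states by their j-th coordinate turns the expectation into the weighted
  norm. The second claim keeps a single summand of it and bounds the initial expectation by 1, as no
  weight exceeds 1.\<close>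

lemma weighted_marginal_decay:
  assumes birth: "\<And>m t. 0 \<le> t \<Longrightarrow> l \<le> lam j m t"
    and death: "\<And>m t. 0 \<le> t \<Longrightarrow> 1 \<le> m $ j \<Longrightarrow> mu j m t \<le> u"
    and "0 \<le> u" "u < l" "0 \<le> t"
  shows "l1_norm (\<lambda>n. sqrt (u / l) ^ n * \<P>(w in Pr p0. X t w $ j = n))
    \<le> exp (- (sqrt l - sqrt u)\<^sup>2 * t) * l1_norm (\<lambda>n. sqrt (u / l) ^ n * \<P>(w in Pr p0. X 0 w $ j = n))"
    and "sqrt (u / l) ^ n * \<P>(w in Pr p0. X t w $ j = n) \<le> exp (- (sqrt l - sqrt u)\<^sup>2 * t)"
proof -
  interpret prob_space "Pr p0" by (rule prob_space)
  have \<sigma>: "0 \<le> sqrt (u / l)" "sqrt (u / l) \<le> 1" using assms by auto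
  obtain q where q: "\<And>A. \<P>(w in Pr p0. X t w \<in> A) = measure_pmf.prob q A"
    using countable_law_pmf[OF measurable[OF \<open>0 \<le> t\<close>]] by blast
  obtain q0 where q0: "\<And>A. \<P>(w in Pr p0. X 0 w \<in> A) = measure_pmf.prob q0 A"
    using countable_law_pmf[OF measurable[OF order_refl]] by blast
  have "pmf q0 m = pmf p0 m" for m
    using q0[of "{m}"] initial[of p0 m] by (simp add: measure_pmf_single)
  then have "q0 = p0" by (rule pmf_eqI)
  have marg: "\<P>(w in Pr p0. X t w $ j = n) = measure_pmf.prob q {m. m $ j = n}"
    "\<P>(w in Pr p0. X 0 w $ j = n) = measure_pmf.prob p0 {m. m $ j = n}" for n
    using q[of "{m. m $ j = n}"] q0[of "{m. m $ j = n}"] \<open>q0 = p0\<close> by simp_all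
  have decay: "measure_pmf.expectation q (\<lambda>m. sqrt (u / l) ^ (m $ j))
    \<le> exp (- (sqrt l - sqrt u)\<^sup>2 * t) * measure_pmf.expectation p0 (\<lambda>m. sqrt (u / l) ^ (m $ j))"
    using q[of "{_}"] by (intro weighted_expectation_decay assms) (auto simp: measure_pmf_single)
  then show "l1_norm (\<lambda>n. sqrt (u / l) ^ n * \<P>(w in Pr p0. X t w $ j = n))
    \<le> exp (- (sqrt l - sqrt u)\<^sup>2 * t) * l1_norm (\<lambda>n. sqrt (u / l) ^ n * \<P>(w in Pr p0. X 0 w $ j = n))"
    unfolding marg l1_norm_weighted_marginal[OF \<sigma>] .
  have "((\<lambda>n. sqrt (u / l) ^ n * pmf (map_pmf (\<lambda>m. m $ j) q) n) has_sum
      measure_pmf.expectation (map_pmf (\<lambda>m. m $ j) q) (\<lambda>n. sqrt (u / l) ^ n)) UNIV"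
    by (rule pmf_expectation_has_sum[where B = 1]) (use \<sigma> in \<open>simp add: power_le_one\<close>)
  from finite_sum_le_has_sum[OF this, of "{n}"] \<sigma>
  have "sqrt (u / l) ^ n * \<P>(w in Pr p0. X t w $ j = n)
      \<le> measure_pmf.expectation q (\<lambda>m. sqrt (u / l) ^ (m $ j))"
    by (simp add: marg pmf_map vimage_def)
  also have "\<dots> \<le> exp (- (sqrt l - sqrt u)\<^sup>2 * t) * measure_pmf.expectation p0 (\<lambda>m. sqrt (u / l) ^ (m $ j))"
    by (rule decay)
  also have "measure_pmf.expectation p0 (\<lambda>m. sqrt (u / l) ^ (m $ j)) \<le> 1"
    by (rule measure_pmf.integral_le_const)
       (use \<sigma> in \<open>auto intro!: measure_pmf.integrable_const_bound[where B = 1] simp: power_le_one\<close>)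
  finally show "sqrt (u / l) ^ n * \<P>(w in Pr p0. X t w $ j = n) \<le> exp (- (sqrt l - sqrt u)\<^sup>2 * t)"
    by simp
qed

text \<open>Started at \<open>a\<close>, the initial expectation is \<sigma>^(a_j), and on the event
  b_j \<le> n the weight is at least \<sigma>^n because \<sigma> \<le> 1. Dividing by \<sigma>^n
  requires 0 < u.\<close>

lemma transition_tail_bound_pos:
  assumes birth: "\<And>m t. 0 \<le> t \<Longrightarrow> l \<le> lam j m t"
    and death: "\<And>m t. 0 \<le> t \<Longrightarrow> 1 \<le> m $ j \<Longrightarrow> mu j m t \<le> u"
    and "0 < u" "u < l" "0 \<le> t"
  shows "measure_pmf.prob (P 0 t a) {b. b $ j \<le> n}
    \<le> sqrt (u / l) powi (int (a $ j) - int n) * exp (- (sqrt l - sqrt u)\<^sup>2 * t)"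
proof -
  let ?p0 = "return_pmf a" and ?\<sigma> = "sqrt (u / l)"
  interpret prob_space "Pr ?p0" by (rule prob_space)
  have \<sigma>: "0 < ?\<sigma>" "?\<sigma> \<le> 1" using assms by auto
  have start: "\<P>(w in Pr ?p0. X 0 w = a) = 1" by (simp add: initial)
  have [measurable]: "X t \<in> measurable (Pr ?p0) (count_space UNIV)"
    "X 0 \<in> measurable (Pr ?p0) (count_space UNIV)" using measurable \<open>0 \<le> t\<close> by auto
  \<comment> \<open>The initial state is almost surely \<open>a\<close>, so conditioning on it
    changes nothing. The Markov property is used with no earlier observations, which makes the
    observed values irrelevant.\<close>
  have law: "\<P>(w in Pr ?p0. X t w = b) = pmf (P 0 t a) b" for b
  proof -
    have "AE w in Pr ?p0. X 0 w = a"
      using start by (subst prob_Collect_eq_1[symmetric]) measurable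
    then have "\<P>(w in Pr ?p0. X t w = b) = \<P>(w in Pr ?p0. X t w = b \<and> X 0 w = a)"
      by (intro prob_eq_AE) auto
    also have "\<dots> = \<P>(w in Pr ?p0. X t w = b \<bar> X 0 w = a \<and> (\<forall>r\<in>{}. X r w = undefined))"
      by (simp add: cond_prob_def start)
    also have "\<dots> = pmf (P 0 t a) b"
      by (rule markov) (use start \<open>0 \<le> t\<close> in auto)
    finally show ?thesis .
  qed
  have "?\<sigma> ^ n * measure_pmf.prob (P 0 t a) {b. b $ j \<le> n}
      = measure_pmf.expectation (P 0 t a) (\<lambda>b. ?\<sigma> ^ n * indicator {b. b $ j \<le> n} b)"
    by simp
  also have "\<dots> \<le> measure_pmf.expectation (P 0 t a) (\<lambda>b. ?\<sigma> ^ (b $ j))"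
    using \<sigma> by (intro integral_mono measure_pmf.integrable_const_bound[where B = 1])
      (auto simp: power_le_one indicator_def intro: power_decreasing)
  also have "\<dots> \<le> exp (- (sqrt l - sqrt u)\<^sup>2 * t) * measure_pmf.expectation ?p0 (\<lambda>m. ?\<sigma> ^ (m $ j))"
    using \<open>0 < u\<close> by (intro weighted_expectation_decay law assms) auto
  finally have "measure_pmf.prob (P 0 t a) {b. b $ j \<le> n}
      \<le> exp (- (sqrt l - sqrt u)\<^sup>2 * t) * ?\<sigma> ^ (a $ j) / ?\<sigma> ^ n"
    using \<sigma> by (simp add: pos_le_divide_eq mult.commute)
  also have "\<dots> = ?\<sigma> powi (int (a $ j) - int n) * exp (- (sqrt l - sqrt u)\<^sup>2 * t)"
  proof -
    have "?\<sigma> \<noteq> 0" using \<sigma> by linarith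
    then have "?\<sigma> powi (int (a $ j) - int n) = ?\<sigma> ^ (a $ j) / ?\<sigma> ^ n"
      by (subst power_int_diff) simp_all
    then show ?thesis by simp
  qed
  finally show ?thesis .
qed

text \<open>For u = 0 every v in (0, l) is also a death bound, and v tends to 0 from the right. With
  n \<le> a_j the exponent is a natural number, so the right-hand side is continuous at 0; for n =
  a_j this includes the value 0^0 = 1.\<close>

lemma transition_tail_bound:
  assumes birth: "\<And>m t. 0 \<le> t \<Longrightarrow> l \<le> lam j m t"
    and death: "\<And>m t. 0 \<le> t \<Longrightarrow> 1 \<le> m $ j \<Longrightarrow> mu j m t \<le> u"
    and "0 \<le> u" "u < l" "0 \<le> t" "u \<noteq> 0 \<or> n \<le> a $ j"
  shows "measure_pmf.prob (P 0 t a) {b. b $ j \<le> n}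
    \<le> sqrt (u / l) powi (int (a $ j) - int n) * exp (- (sqrt l - sqrt u)\<^sup>2 * t)"
proof (cases "u = 0")
  case True
  with assms have n: "n \<le> a $ j" by simp
  have powi: "y powi (int (a $ j) - int n) = y ^ (a $ j - n)" for y :: real
    using n by (metis of_nat_diff power_int_of_nat)
  let ?f = "\<lambda>v. sqrt (v / l) ^ (a $ j - n) * exp (- (sqrt l - sqrt v)\<^sup>2 * t)"
  have "continuous (at_right 0) ?f"
    using assms by (intro continuous_intros) auto
  then have "(?f \<longlongrightarrow> ?f 0) (at_right 0)" by (simp add: continuous_within)
  moreover have "\<forall>\<^sub>F v in at_right 0. measure_pmf.prob (P 0 t a) {b. b $ j \<le> n} \<le> ?f v"
  proof -
    have "\<forall>\<^sub>F v in at_right 0. v \<in> {0<..<l}"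
      using assms by (intro eventually_at_right_real) auto
    then show ?thesis
    proof eventually_elim
      case (elim v)
      have "mu j m t \<le> v" if "0 \<le> t" "1 \<le> m $ j" for m t
        using death[OF that] elim True by simp
      then show ?case
        using transition_tail_bound_pos[OF birth, of v t a n] elim assms by (simp only: powi) simp
    qed
  qed
  ultimately have "measure_pmf.prob (P 0 t a) {b. b $ j \<le> n} \<le> ?f 0"
    by (rule tendsto_lowerbound) simp
  then show ?thesis by (simp only: powi True)
next
  case False
  then show ?thesis using assms by (intro transition_tail_bound_pos) auto
qed

text \<open>Given the initial state, the bound \<open>c\<close> holds uniformly over
  \<open>A\<close>, and averaging preserves it. The event that fixes one coordinate may contain
  infinitely many states, so the joint law of the initial and the later state is needed, not just
  one starting point.\<close>

lemma conditional_le_transition_bound: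
  assumes "0 \<le> t" "0 \<le> c"
    and c: "\<And>a. a \<in> A \<Longrightarrow> measure_pmf.prob (P 0 t a) B \<le> c"
    and pos: "0 < \<P>(w in Pr p0. X 0 w \<in> A)"
  shows "\<P>(w in Pr p0. X t w \<in> B \<bar> X 0 w \<in> A) \<le> c"
proof -
  interpret prob_space "Pr p0" by (rule prob_space)
  have [measurable]: "X t \<in> measurable (Pr p0) (count_space UNIV)"
    "X 0 \<in> measurable (Pr p0) (count_space UNIV)" using measurable \<open>0 \<le> t\<close> by auto
  have Y: "(\<lambda>w. (X 0 w, X t w)) \<in> measurable (Pr p0) (count_space UNIV)"
    using measurable_Pair[of "X 0" "Pr p0" "count_space UNIV" "X t" "count_space UNIV"]
    by (simp add: pair_measure_countable)
  obtain r where r: "\<And>S. \<P>(w in Pr p0. (X 0 w, X t w) \<in> S) = measure_pmf.prob r S"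
    using countable_law_pmf[OF Y] by blast
  \<comment> \<open>The joint law is the mixture of the kernels over \<open>p0\<close>. Where
    \<open>p0\<close> has no mass the Markov property says nothing, but both sides are 0.\<close>
  have "pmf r (a, b) = pmf (bind_pmf p0 (\<lambda>a. map_pmf (Pair a) (P 0 t a))) (a, b)" for a b
  proof -
    have joint: "pmf r (a, b) = \<P>(w in Pr p0. X t w = b \<and> X 0 w = a)"
      using r[of "{(a, b)}"] by (simp add: measure_pmf_single conj_commute)
    have "\<P>(w in Pr p0. X t w = b \<and> X 0 w = a) = pmf p0 a * pmf (P 0 t a) b"
    proof (cases "pmf p0 a = 0")
      case True
      have "\<P>(w in Pr p0. X t w = b \<and> X 0 w = a) \<le> \<P>(w in Pr p0. X 0 w = a)"
        by (intro finite_measure_mono) auto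
      then show ?thesis using True initial[of p0 a] by (simp add: measure_le_0_iff)
    next
      case False
      then have "0 < pmf p0 a" by (simp add: pmf_nonneg less_le)
      then have "\<P>(w in Pr p0. X t w = b \<bar> X 0 w = a \<and> (\<forall>r\<in>{}. X r w = undefined)) = pmf (P 0 t a) b"
        using initial[of p0 a] \<open>0 \<le> t\<close> by (intro markov) auto
      then show ?thesis using False initial[of p0 a] by (simp add: cond_prob_def field_simps)
    qed
    moreover have "pmf (bind_pmf p0 (\<lambda>a. map_pmf (Pair a) (P 0 t a))) (a, b)
        = pmf p0 a * pmf (P 0 t a) b"
    proof -
      have "Pair x -` {(a, b)} = (if x = a then {b} else {})" for x :: "nat^'d" by auto
      then have "pmf (map_pmf (Pair x) (P 0 t x)) (a, b) = indicator {a} x * pmf (P 0 t a) b" for x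
        by (simp add: pmf_map measure_pmf_single)
      then show ?thesis by (simp add: pmf_bind measure_pmf_single)
    qed
    ultimately show ?thesis using joint by simp
  qed
  then have r_eq: "r = bind_pmf p0 (\<lambda>a. map_pmf (Pair a) (P 0 t a))"
    by (intro pmf_eqI) auto
  have "emeasure (measure_pmf r) (A \<times> B) = (\<integral>\<^sup>+a. emeasure (measure_pmf (P 0 t a)) (Pair a -` (A \<times> B)) \<partial>p0)"
    by (simp add: r_eq)
  also have "\<dots> \<le> (\<integral>\<^sup>+a. ennreal c * indicator A a \<partial>p0)"
    using c by (intro nn_integral_mono)
      (auto simp: indicator_def measure_pmf.emeasure_eq_measure ennreal_leI vimage_def)
  also have "\<dots> = ennreal (c * measure_pmf.prob p0 A)"
    using \<open>0 \<le> c\<close> by (simp add: nn_integral_cmult measure_pmf.emeasure_eq_measure ennreal_mult)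
  finally have "measure_pmf.prob r (A \<times> B) \<le> c * measure_pmf.prob p0 A"
    using \<open>0 \<le> c\<close> by (simp add: measure_pmf.emeasure_eq_measure)
  moreover have "measure_pmf.prob p0 A = \<P>(w in Pr p0. X 0 w \<in> A)"
  proof -
    have "map_pmf fst r = p0" by (simp add: r_eq map_bind_pmf pmf.map_comp o_def bind_return_pmf')
    then have "measure_pmf.prob p0 A = measure_pmf.prob r (fst -` A)" by (metis measure_map_pmf)
    then show ?thesis using r[of "fst -` A"] by simp
  qed
  ultimately show ?thesis
    using pos r[of "A \<times> B"] by (simp add: cond_prob_def divide_le_eq conj_commute)
qed

end

section \<open>Null-ergodicity, decay of the weighted norm and the conditional bound\<close>

theorem theorem1:
  fixes lam mu :: "'d::finite \<Rightarrow> nat^'d \<Rightarrow> real \<Rightarrow> real"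
    and P :: "real \<Rightarrow> real \<Rightarrow> nat^'d \<Rightarrow> (nat^'d) pmf"
    and Pr :: "(nat^'d) pmf \<Rightarrow> 'w measure"
    and X :: "real \<Rightarrow> 'w \<Rightarrow> nat^'d"
    and j :: 'd
    and lj Lj mj Mj :: real
  defines "\<sigma> \<equiv> sqrt (Mj / lj)"
    and "\<alpha> \<equiv> (sqrt lj - sqrt Mj)\<^sup>2"
    and "x \<equiv> \<lambda>p0 t k. \<P>(w in Pr p0. X t w $ j = k)"
  assumes process: "birth_death_process lam mu P Pr X"
    and const_nonneg: "0 \<le> lj" "0 \<le> Lj" "0 \<le> mj" "0 \<le> Mj"
    and birth_bounds: "\<And>m t. 0 \<le> t \<Longrightarrow> lj \<le> lam j m t \<and> lam j m t \<le> Lj"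
    and death_bounds: "\<And>m t. 0 \<le> t \<Longrightarrow> 1 \<le> m $ j \<Longrightarrow> mj \<le> mu j m t \<and> mu j m t \<le> Mj"
    and "Mj < lj"
  shows "null_ergodic Pr (\<lambda>t w. X t w $ j)
    \<and> (\<forall>p0. \<forall>t\<ge>0. l1_norm (\<lambda>n. \<sigma> ^ n * x p0 t n)
                     \<le> exp (- \<alpha> * t) * l1_norm (\<lambda>n. \<sigma> ^ n * x p0 0 n))
    \<and> (\<forall>n k p0. \<forall>t\<ge>0. \<P>(w in Pr p0. X 0 w $ j = k) > 0 \<longrightarrow> (\<sigma> \<noteq> 0 \<or> n \<le> k) \<longrightarrow>
          \<P>(w in Pr p0. X t w $ j \<le> n \<bar> X 0 w $ j = k)
            \<le> \<sigma> powi (int k - int n) * exp (- \<alpha> * t))"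
proof -
  interpret birth_death_process lam mu P Pr X by (rule process)
  have death: "mu j m t \<le> Mj" if "0 \<le> t" "1 \<le> m $ j" for m t
    using death_bounds[OF that] by simp
  have birth: "lj \<le> lam j m t" if "0 \<le> t" for m t
    using birth_bounds[OF that] by simp
  have "0 < lj" using const_nonneg \<open>Mj < lj\<close> by linarith
  have ergodic: "null_ergodic Pr (\<lambda>t w. X t w $ j)"
    unfolding null_ergodic_def
  proof (intro allI)
    fix p0 k
    \<comment> \<open>Any constant strictly between the rates bounds the deaths as well, and it keeps the
      weights positive when no death is possible.\<close>
    define u where "u = (Mj + lj) / 2"
    have u: "Mj \<le> u" "0 < u" "u < lj"
      using const_nonneg \<open>Mj < lj\<close> by (auto simp: u_def)
    define a where "a = (sqrt lj - sqrt u)\<^sup>2"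
    have "0 < sqrt lj - sqrt u" using u by simp
    then have "0 < a" by (simp add: a_def)
    then have "((\<lambda>t. exp (- a * t)) \<longlongrightarrow> 0) at_top"
      by (intro filterlim_compose[OF exp_at_bot]
          filterlim_tendsto_neg_mult_at_bot[OF tendsto_const] filterlim_ident) auto
    then have lim: "((\<lambda>t. exp (- a * t) / sqrt (u / lj) ^ k) \<longlongrightarrow> 0) at_top"
      by (rule tendsto_divide_zero)
    show "((\<lambda>t. \<P>(w in Pr p0. X t w $ j = k)) \<longlongrightarrow> 0) at_top"
    proof (rule tendsto_sandwich[OF _ _ tendsto_const lim])
      show "\<forall>\<^sub>F t in at_top. \<P>(w in Pr p0. X t w $ j = k) \<le> exp (- a * t) / sqrt (u / lj) ^ k"
        using eventually_ge_at_top[of 0]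
      proof eventually_elim
        case (elim t)
        have "mu j m t \<le> u" if "0 \<le> t" "1 \<le> m $ j" for m t
          using death[OF that] u(1) by linarith
        then have "sqrt (u / lj) ^ k * \<P>(w in Pr p0. X t w $ j = k) \<le> exp (- a * t)"
          unfolding a_def using birth u elim by (intro weighted_marginal_decay(2)) auto
        moreover have "0 < sqrt (u / lj) ^ k" using u by simp
        ultimately show ?case by (simp only: pos_le_divide_eq mult.commute)
      qed
    qed simp
  qed
  have decay: "l1_norm (\<lambda>n. \<sigma> ^ n * x p0 t n) \<le> exp (- \<alpha> * t) * l1_norm (\<lambda>n. \<sigma> ^ n * x p0 0 n)"
    if "0 \<le> t" for p0 t
    unfolding \<sigma>_def \<alpha>_def x_def
    by (rule weighted_marginal_decay(1)[OF birth death const_nonneg(4) \<open>Mj < lj\<close> that])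
  \<comment> \<open>For \<sigma> = 0 and n > k the term \<open>\<sigma> powi (int k - int n)\<close>
    evaluates to 0 instead of the intended infinite value. The guard removes exactly this case, in
    which the bound is vacuous.\<close>
  have tail: "\<P>(w in Pr p0. X t w $ j \<le> n \<bar> X 0 w $ j = k) \<le> \<sigma> powi (int k - int n) * exp (- \<alpha> * t)"
    if "0 \<le> t" "\<P>(w in Pr p0. X 0 w $ j = k) > 0" "\<sigma> \<noteq> 0 \<or> n \<le> k" for n k p0 t
  proof -
    have "measure_pmf.prob (P 0 t a) {b. b $ j \<le> n} \<le> \<sigma> powi (int k - int n) * exp (- \<alpha> * t)"
      if "a \<in> {a. a $ j = k}" for a
      using transition_tail_bound[OF birth death const_nonneg(4) \<open>Mj < lj\<close> \<open>0 \<le> t\<close>, of n a]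
        that \<open>\<sigma> \<noteq> 0 \<or> n \<le> k\<close> \<open>0 < lj\<close> by (simp add: \<sigma>_def \<alpha>_def)
    moreover have "0 \<le> \<sigma> powi (int k - int n) * exp (- \<alpha> * t)"
      using const_nonneg \<open>0 < lj\<close> by (simp add: \<sigma>_def)
    ultimately show ?thesis
      using conditional_le_transition_bound[of t _ "{a. a $ j = k}" "{b. b $ j \<le> n}" p0] that by simp
  qed
  show ?thesis using ergodic decay tail by blast
qed

end
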